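(* Let $F\in C^2(\Omega)$ and let $u:[t_0,T]\to\mathbb{R}$ be a solution of $u'(t)=F(t,u(t))$, $t\in(t_0,T)$, $u(t_0)=u_0$. Suppose that there exist constants $H>0$ and $\eta>0$ such that, for every $h\in(0,H]$, a sequence $\{\sigma_n\}_{n=0}^{N_h-1}$ of positive scales (which may depend on $h$) is given such that $\sigma_n^2+u'(t_n)^2\ge\eta$ for every $n=0,1,\ldots,N_h-1$. Let $\ell_{n+1}$ denote the corresponding local truncation errors of the specular ellipse method (SE). Then the following hold. (a) Suppose that $u\in C^3([t_0,T])$. Then SE is consistent of order 2. More precisely, there exist constants $h_1\in(0,H]$ and $C>0$, independent of $h$ and $n$, such that $|\ell_{n+1}|\le Ch^2$ whenever $0<h\le h_1$ and $t_{n+1}\le T$. (b) Suppose that $u\in C^4([t_0,T])$ and that the positive scales $\sigma_n$ are chosen such that $\kappa_{\sigma_n}'(t_n)=0$ for every $n$ such that $t_{n+1}\le T$. Then SE is consistent of order 3. More precisely, there exist constants $h_2\in(0,H]$ and $C>0$, independent of $h$ and $n$, such that $|\ell_{n+1}|\le Ch^3$ whenever $0<h\le h_2$ and $t_{n+1}\le T$. (c) Suppose that $u\in C^5([t_0,T])$ and that the positive scales $\sigma_n$ are chosen such that $$\left\|\gamma_{\sigma_n}'(t_n)\right\|^3\kappa_{\sigma_n}'(t_n)+\left\|\gamma_{\sigma_n}'(t_{n+1})\right\|^3\kappa_{\sigma_n}'(t_{n+1})=0$$ for every $n$ such that $t_{n+1}\le T$. Then SE is consistent of order 4. More precisely, there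 exist constants $h_3\in(0,H]$ and $C>0$, independent of $h$ and $n$, such that $|\ell_{n+1}|\le Ch^4$ whenever $0<h\le h_3$ and $t_{n+1}\le T$.
   Context: Let $\Omega\subset\mathbb{R}^2$ be open, $F:\Omega\to\mathbb{R}$, $t_0\ge 0$, $T>t_0$, $u_0\in\mathbb{R}$ with $(t_0,u_0)\in\Omega$. A solution $u:[t_0,T]\to\mathbb{R}$ satisfies $(t,u(t))\in\Omega$ for every $t\in[t_0,T]$. For $h>0$ put $N_h:=\lfloor h^{-1}(T-t_0)\rfloor$ and $t_n:=t_0+nh$. For $\sigma>0$ define $\mathcal{C}_\sigma(\alpha,\beta):=\sigma\,\mathcal{C}(\alpha/\sigma,\beta/\sigma)$, where $$\mathcal{C}(\alpha,\beta):=\left(\frac{\alpha}{\sqrt{1+\alpha^2}}+\frac{\beta}{\sqrt{1+\beta^2}}\right)\left(\frac{1}{\sqrt{1+\alpha^2}}+\frac{1}{\sqrt{1+\beta^2}}\right)^{-1}.$$ The specular ellipse method (SE) with positive scales $\{\sigma_n\}$ is the implicit one-step method $u_{n+1}=u_n+h\,\mathcal{C}_{\sigma_n}(F(t_{n+1},u_{n+1}),F(t_n,u_n))$, $u_0=u(t_0)$. Its local truncation error is $$\ell_{n+1}:=\frac{u(t_{n+1})-u(t_n)}{h}-\mathcal{C}_{\sigma_n}\bigl(F(t_{n+1},u(t_{n+1})),F(t_n,u(t_n))\bigr),\qquad n=0,\ldots,N_h-1.$$ For $\sigma>0$ and $t\in[t_0,T]$: $\gamma_\sigma(t):=(t,u(t)/\sigma)$,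 so that $\|\gamma_\sigma'(t)\|=\sqrt{1+u'(t)^2/\sigma^2}$ (Euclidean norm), and the signed curvature is $\kappa_\sigma(t):=\dfrac{\sigma^2u''(t)}{(\sigma^2+u'(t)^2)^{3/2}}$; $\kappa_\sigma'$ is its derivative in $t$ (one-sided at the endpoints). *)

theory Defs
  imports "HOL-Analysis.Analysis"
begin

text \<open>
  Derivatives are taken within a set \<open>S\<close>, so that on \<open>S = {t0..T}\<close> with \<open>t0 < T\<close> they are
  one-sided at the endpoints and the values of the function outside \<open>S\<close> are irrelevant.
\<close>

definition deriv_on :: "real set \<Rightarrow> (real \<Rightarrow> 'a::real_normed_vector) \<Rightarrow> real \<Rightarrow> 'a" where
  "deriv_on S f t = vector_derivative f (at t within S)"

text \<open>
  The class \<open>C\<^sup>k(S)\<close>. This is meant for open \<open>S\<close> and for nondegenerate compact intervals of the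
  real line, where the derivative within \<open>S\<close> is unique.
\<close>

primrec Ck_on :: "nat \<Rightarrow> ('a::real_normed_vector \<Rightarrow> 'b::real_normed_vector) \<Rightarrow> 'a set \<Rightarrow> bool" where
  "Ck_on 0 f S \<longleftrightarrow> continuous_on S f"
| "Ck_on (Suc k) f S \<longleftrightarrow>
     f differentiable_on S \<and> (\<forall>v. Ck_on k (\<lambda>x. frechet_derivative f (at x within S) v) S)"

definition is_solution ::
  "(real \<times> real) set \<Rightarrow> (real \<times> real \<Rightarrow> real) \<Rightarrow> real \<Rightarrow> real \<Rightarrow> real \<Rightarrow> (real \<Rightarrow> real) \<Rightarrow> bool" where
  "is_solution \<Omega> F t0 T u0 u \<longleftrightarrow>
     (\<forall>t\<in>{t0..T}. (t, u t) \<in> \<Omega>) \<and>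
     (\<forall>t\<in>{t0<..<T}. (u has_real_derivative F (t, u t)) (at t)) \<and>
     u t0 = u0"

definition num_steps :: "real \<Rightarrow> real \<Rightarrow> real \<Rightarrow> nat" where
  "num_steps t0 T h = nat \<lfloor>(T - t0) / h\<rfloor>"

definition grid :: "real \<Rightarrow> real \<Rightarrow> nat \<Rightarrow> real" where
  "grid t0 h n = t0 + real n * h"

definition C_avg :: "real \<Rightarrow> real \<Rightarrow> real" where
  "C_avg \<alpha> \<beta> =
     (\<alpha> / sqrt (1 + \<alpha>\<^sup>2) + \<beta> / sqrt (1 + \<beta>\<^sup>2)) *
     inverse (1 / sqrt (1 + \<alpha>\<^sup>2) + 1 / sqrt (1 + \<beta>\<^sup>2))"

definition C_scaled :: "real \<Rightarrow> real \<Rightarrow> real \<Rightarrow> real" where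
  "C_scaled \<sigma> \<alpha> \<beta> = \<sigma> * C_avg (\<alpha> / \<sigma>) (\<beta> / \<sigma>)"

text \<open>
  \<open>SE_lte F u t0 h \<sigma> n\<close> is the error usually indexed by \<open>n + 1\<close>: the residual of \<open>u\<close> in the step
  from \<open>grid t0 h n\<close> to \<open>grid t0 h (n + 1)\<close> of the specular ellipse method
  \<open>v (n + 1) = v n + h * C_scaled (\<sigma> n) (F (t (n + 1), v (n + 1))) (F (t n, v n))\<close>,
  divided by \<open>h\<close>.
\<close>

definition SE_lte ::
  "(real \<times> real \<Rightarrow> real) \<Rightarrow> (real \<Rightarrow> real) \<Rightarrow> real \<Rightarrow> real \<Rightarrow> (nat \<Rightarrow> real) \<Rightarrow> nat \<Rightarrow> real" where
  "SE_lte F u t0 h \<sigma> n =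
     (u (grid t0 h (n + 1)) - u (grid t0 h n)) / h -
     C_scaled (\<sigma> n)
       (F (grid t0 h (n + 1), u (grid t0 h (n + 1))))
       (F (grid t0 h n, u (grid t0 h n)))"

definition scaled_graph :: "real \<Rightarrow> (real \<Rightarrow> real) \<Rightarrow> real \<Rightarrow> real \<times> real" where
  "scaled_graph \<sigma> u t = (t, u t / \<sigma>)"

definition graph_speed :: "real set \<Rightarrow> real \<Rightarrow> (real \<Rightarrow> real) \<Rightarrow> real \<Rightarrow> real" where
  "graph_speed S \<sigma> u t = norm (deriv_on S (scaled_graph \<sigma> u) t)"

definition signed_curvature :: "real set \<Rightarrow> real \<Rightarrow> (real \<Rightarrow> real) \<Rightarrow> real \<Rightarrow> real" where
  "signed_curvature S \<sigma> u t =
     \<sigma>\<^sup>2 * deriv_on S (deriv_on S u) t / (\<sigma>\<^sup>2 + (deriv_on S u t)\<^sup>2) powr (3 / 2)"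

definition curvature_deriv :: "real set \<Rightarrow> real \<Rightarrow> (real \<Rightarrow> real) \<Rightarrow> real \<Rightarrow> real" where
  "curvature_deriv S \<sigma> u t = deriv_on S (signed_curvature S \<sigma> u) t"

end

theory Submission
  imports Defs
begin

text \<open>
  With \<open>A = sqrt (\<sigma>\<^sup>2 + \<alpha>\<^sup>2)\<close> and \<open>B = sqrt (\<sigma>\<^sup>2 + \<beta>\<^sup>2)\<close> the scaled average is the arithmetic mean of
  the slopes minus \<open>(\<alpha> - \<beta>)\<^sup>2 (\<alpha> + \<beta>) / (2 (A + B)\<^sup>2)\<close>. Hence the truncation error is that of the
  trapezoidal rule plus this term, which is \<open>O(h\<^sup>2)\<close> because \<open>\<alpha> - \<beta> = O(h)\<close>. The \<open>h\<^sup>2\<close> coefficient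
  of the sum at \<open>t\<close> is \<open>-E(t) / 12\<close> with \<open>E = u''' - 3 u' u''\<^sup>2 / (\<sigma>\<^sup>2 + u'\<^sup>2)\<close>, and \<open>\<kappa>'\<close> is a nonzero
  multiple of \<open>E\<close>, while the cubed speed times \<open>\<kappa>'\<close> is \<open>E / \<sigma>\<close>. In the symmetric form, with \<open>E(t)\<close>
  replaced by the mean of \<open>E\<close> over both endpoints, the \<open>h\<^sup>3\<close> term vanishes as well. All
  bounds depend on \<open>\<sigma>\<close> only through lower bounds on \<open>A\<close> and \<open>B\<close>, so they are uniform in the scale.
\<close>

section \<open>Iterated derivatives on an interval and the mean value inequality\<close>

text \<open>On the reals a Frechet derivative is multiplication by its value at 1, so the choice
  \<open>v = 1\<close> turns the recursion of \<open>Ck_on\<close> into a chain of ordinary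
  derivatives, each step using up one order.\<close>

lemma Ck_on_real_derivative:
  fixes f :: "real \<Rightarrow> real"
  assumes "Ck_on k f S" "0 < k"
  obtains g where "\<And>x. x \<in> S \<Longrightarrow> (f has_real_derivative g x) (at x within S)" "Ck_on (k - 1) g S"
proof -
  obtain m where m: "k = Suc m"
    using assms(2) gr0_implies_Suc by blast
  let ?g = "\<lambda>x. frechet_derivative f (at x within S) 1"
  have "(f has_real_derivative ?g x) (at x within S)" if "x \<in> S" for x
  proof -
    have "(f has_derivative frechet_derivative f (at x within S)) (at x within S)"
      using assms that by (simp add: m differentiable_on_def frechet_derivative_works)
    moreover from this obtain D where "frechet_derivative f (at x within S) = (\<lambda>v. v * D)"
      using has_derivative_bounded_linear real_bounded_linear by blast
    ultimately show ?thesis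
      by (simp add: has_field_derivative_def mult_commute_abs)
  qed
  moreover have "Ck_on (k - 1) ?g S"
    using assms by (simp add: m)
  ultimately show thesis ..
qed

lemma Ck_on_imp_continuous_on:
  assumes "Ck_on k f S"
  shows "continuous_on S f"
  using assms by (cases k) (auto intro: differentiable_imp_continuous_on)

lemma Ck_on_bounded:
  fixes f :: "real \<Rightarrow> real"
  assumes "Ck_on k f {a..b}"
  obtains M where "\<And>x. x \<in> {a..b} \<Longrightarrow> \<bar>f x\<bar> \<le> M"
proof -
  have "compact (f ` {a..b})"
    using assms by (intro compact_continuous_image Ck_on_imp_continuous_on) auto
  then have "bounded (f ` {a..b})"
    by (rule compact_imp_bounded)
  then obtain M where "\<forall>y\<in>f ` {a..b}. norm y \<le> M"
    unfolding bounded_iff by blast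
  then show thesis
    using that by force
qed

lemma deriv_on_eqI:
  assumes "(f has_vector_derivative D) (at t within {a..b})" "a < b" "t \<in> {a..b}"
  shows "deriv_on {a..b} f t = D"
  unfolding deriv_on_def using assms
  by (metis box_real(2) vector_derivative_within_cbox atLeastAtMost_iff)

lemma deriv_on_real_eqI:
  fixes f :: "real \<Rightarrow> real"
  assumes "(f has_real_derivative D) (at t within {a..b})" "a < b" "t \<in> {a..b}"
  shows "deriv_on {a..b} f t = D"
  using assms by (intro deriv_on_eqI) (simp_all add: has_real_derivative_iff_has_vector_derivative)

text \<open>Mean value inequality on \<open>{a..x}\<close>, where the derivative is at most
  \<open>K * (x - a) ^ n\<close> throughout. Integration would give \<open>K / (n + 1)\<close>;
  keeping \<open>K\<close> lets repeated applications carry a single constant while each raises the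
  order of vanishing by one. The case \<open>n = 0\<close> is the Lipschitz bound.\<close>

lemma derivative_power_bound:
  fixes f f' :: "real \<Rightarrow> real"
  assumes deriv: "\<And>x. x \<in> {a..b} \<Longrightarrow> (f has_real_derivative f' x) (at x within {a..b})"
    and bound: "\<And>x. x \<in> {a..b} \<Longrightarrow> \<bar>f' x\<bar> \<le> K * (x - a) ^ n"
    and x: "x \<in> {a..b}"
  shows "\<bar>f x - f a\<bar> \<le> K * (x - a) ^ Suc n"
proof (cases "x = a")
  case False
  with x have "a < x" by simp
  \<comment> \<open>The sign of \<open>K\<close> is read off from the bound at a point
    \<open>x > a\<close>; the comparison of powers below needs it.\<close>
  have K: "0 \<le> K"
  proof -
    have "0 \<le> K * (x - a) ^ n" using bound[OF x] by linarith
    moreover have "0 < (x - a) ^ n" using \<open>a < x\<close> by simp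
    ultimately show ?thesis by (auto simp: zero_le_mult_iff)
  qed
  have "\<bar>f x - f a\<bar> \<le> K * (x - a) ^ n * \<bar>x - a\<bar>"
  proof -
    have "norm (f x - f a) \<le> K * (x - a) ^ n * norm (x - a)"
    proof (rule field_differentiable_bound[where S = "{a..x}" and f' = f'])
      fix z assume z: "z \<in> {a..x}"
      with x show "(f has_field_derivative f' z) (at z within {a..x})"
        by (intro DERIV_subset[OF deriv]) auto
      have "\<bar>f' z\<bar> \<le> K * (z - a) ^ n" using bound z x by auto
      also have "\<dots> \<le> K * (x - a) ^ n"
        using z K by (intro mult_left_mono power_mono) auto
      finally show "norm (f' z) \<le> K * (x - a) ^ n" by simp
    qed (use \<open>a < x\<close> in auto)
    then show ?thesis by simp
  qed
  then show ?thesis using \<open>a < x\<close> by (simp add: mult_ac)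
qed simp

section \<open>Remainders of the trapezoidal rule\<close>

text \<open>With \<open>f'\<close> the derivative of \<open>f\<close>, this is the error of the
  trapezoidal rule for the integral of \<open>f'\<close> from \<open>t\<close> to
  \<open>x\<close>.\<close>

definition trapezoid_remainder :: "(real \<Rightarrow> real) \<Rightarrow> (real \<Rightarrow> real) \<Rightarrow> real \<Rightarrow> real \<Rightarrow> real" where
  "trapezoid_remainder f f' t x = f x - f t - (x - t) / 2 * (f' x + f' t)"

text \<open>As a function of \<open>x\<close>, the remainder and its derivative \<open>?R1\<close>
  vanish at \<open>t\<close>, and the second derivative is \<open>- (x - t) / 2 * f3 x\<close>. This
  is of first order in \<open>x - t\<close>, and two applications of
  \<open>derivative_power_bound\<close> raise it to third order.\<close>

lemma trapezoid_bound:
  fixes f f1 f2 f3 :: "real \<Rightarrow> real"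
  assumes d1: "\<And>x. x \<in> {t..b} \<Longrightarrow> (f has_real_derivative f1 x) (at x within {t..b})"
    and d2: "\<And>x. x \<in> {t..b} \<Longrightarrow> (f1 has_real_derivative f2 x) (at x within {t..b})"
    and d3: "\<And>x. x \<in> {t..b} \<Longrightarrow> (f2 has_real_derivative f3 x) (at x within {t..b})"
    and bound: "\<And>x. x \<in> {t..b} \<Longrightarrow> \<bar>f3 x\<bar> \<le> M"
    and x: "x \<in> {t..b}"
  shows "\<bar>trapezoid_remainder f f1 t x\<bar> \<le> M * (x - t) ^ 3"
proof -
  let ?R1 = "\<lambda>x. (f1 x - f1 t) / 2 - (x - t) / 2 * f2 x"
  have R1: "\<bar>?R1 y\<bar> \<le> M * (y - t) ^ 2" if y: "y \<in> {t..b}" for y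
  proof -
    have "\<bar>?R1 y - ?R1 t\<bar> \<le> M * (y - t) ^ Suc 1"
    proof (rule derivative_power_bound[where f' = "\<lambda>x. - (x - t) / 2 * f3 x"])
      fix z assume z: "z \<in> {t..b}"
      show "(?R1 has_real_derivative - (z - t) / 2 * f3 z) (at z within {t..b})"
        by (rule derivative_eq_intros d2[OF z] d3[OF z] refl | simp)+ (simp add: field_simps)
      have "\<bar>- (z - t) / 2 * f3 z\<bar> = (z - t) / 2 * \<bar>f3 z\<bar>"
        using z by (simp add: abs_mult)
      also have "\<dots> \<le> (z - t) * M"
        using z bound[OF z] by (intro mult_mono) auto
      finally show "\<bar>- (z - t) / 2 * f3 z\<bar> \<le> M * (z - t) ^ 1" by (simp add: mult.commute)
    qed (use y in auto)
    then show ?thesis by (simp add: power2_eq_square)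
  qed
  have "\<bar>trapezoid_remainder f f1 t x - trapezoid_remainder f f1 t t\<bar> \<le> M * (x - t) ^ Suc 2"
  proof (rule derivative_power_bound[OF _ R1])
    fix z assume z: "z \<in> {t..b}"
    show "(trapezoid_remainder f f1 t has_real_derivative ?R1 z) (at z within {t..b})"
      unfolding trapezoid_remainder_def
      by (rule derivative_eq_intros d1[OF z] d2[OF z] refl | simp)+ (simp add: field_simps)
  qed (use x in auto)
  then show ?thesis by (simp add: trapezoid_remainder_def eval_nat_numeral)
qed

text \<open>The cubic term changes the second derivative of the remainder to
  \<open>- (x - t) / 2 * (f3 x - f3 t)\<close>. As \<open>f3\<close> is Lipschitz, this is of second
  order, and integrating twice gives order four.\<close>

lemma trapezoid_expansion_left:
  fixes f f1 f2 f3 f4 :: "real \<Rightarrow> real"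
  assumes d1: "\<And>x. x \<in> {t..b} \<Longrightarrow> (f has_real_derivative f1 x) (at x within {t..b})"
    and d2: "\<And>x. x \<in> {t..b} \<Longrightarrow> (f1 has_real_derivative f2 x) (at x within {t..b})"
    and d3: "\<And>x. x \<in> {t..b} \<Longrightarrow> (f2 has_real_derivative f3 x) (at x within {t..b})"
    and d4: "\<And>x. x \<in> {t..b} \<Longrightarrow> (f3 has_real_derivative f4 x) (at x within {t..b})"
    and bound: "\<And>x. x \<in> {t..b} \<Longrightarrow> \<bar>f4 x\<bar> \<le> M"
    and x: "x \<in> {t..b}"
  shows "\<bar>trapezoid_remainder f f1 t x + (x - t) ^ 3 / 12 * f3 t\<bar> \<le> M * (x - t) ^ 4"
proof -
  have diff3: "\<bar>f3 z - f3 t\<bar> \<le> M * (z - t)" if "z \<in> {t..b}" for z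
    using derivative_power_bound[OF d4, of M 0 z] bound that by simp
  let ?R0 = "\<lambda>x. f x - f t - (x - t) / 2 * (f1 x + f1 t) + (x - t) ^ 3 / 12 * f3 t"
  let ?R1 = "\<lambda>x. (f1 x - f1 t) / 2 - (x - t) / 2 * f2 x + (x - t) ^ 2 / 4 * f3 t"
  let ?R2 = "\<lambda>x. - (x - t) / 2 * (f3 x - f3 t)"
  have R2: "\<bar>?R2 z\<bar> \<le> M * (z - t) ^ 2" if z: "z \<in> {t..b}" for z
  proof -
    have "\<bar>?R2 z\<bar> = (z - t) / 2 * \<bar>f3 z - f3 t\<bar>"
      using z by (simp add: abs_mult)
    also have "\<dots> \<le> (z - t) * (M * (z - t))"
      using z diff3[OF z] by (intro mult_mono) auto
    finally show ?thesis by (simp add: power2_eq_square mult_ac)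
  qed
  have R1: "\<bar>?R1 y\<bar> \<le> M * (y - t) ^ 3" if y: "y \<in> {t..b}" for y
  proof -
    have "\<bar>?R1 y - ?R1 t\<bar> \<le> M * (y - t) ^ Suc 2"
    proof (rule derivative_power_bound[OF _ R2])
      fix z assume z: "z \<in> {t..b}"
      show "(?R1 has_real_derivative ?R2 z) (at z within {t..b})"
        by (rule derivative_eq_intros d2[OF z] d3[OF z] refl | simp)+ (simp add: field_simps)
    qed (use y in auto)
    then show ?thesis by (simp add: eval_nat_numeral)
  qed
  have "\<bar>?R0 x - ?R0 t\<bar> \<le> M * (x - t) ^ Suc 3"
  proof (rule derivative_power_bound[OF _ R1])
    fix z assume z: "z \<in> {t..b}"
    show "(?R0 has_real_derivative ?R1 z) (at z within {t..b})"
      by (rule derivative_eq_intros d1[OF z] d2[OF z] refl | simp)+ (simp add: field_simps)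
  qed (use x in auto)
  then show ?thesis by (simp add: trapezoid_remainder_def eval_nat_numeral)
qed

text \<open>Averaging the third derivative over both endpoints also absorbs the fourth-order term,
  so the second derivative of the expression is already of third order.\<close>

lemma trapezoid_expansion_symmetric:
  fixes f f1 f2 f3 f4 f5 :: "real \<Rightarrow> real"
  assumes d1: "\<And>x. x \<in> {t..b} \<Longrightarrow> (f has_real_derivative f1 x) (at x within {t..b})"
    and d2: "\<And>x. x \<in> {t..b} \<Longrightarrow> (f1 has_real_derivative f2 x) (at x within {t..b})"
    and d3: "\<And>x. x \<in> {t..b} \<Longrightarrow> (f2 has_real_derivative f3 x) (at x within {t..b})"
    and d4: "\<And>x. x \<in> {t..b} \<Longrightarrow> (f3 has_real_derivative f4 x) (at x within {t..b})"
    and d5: "\<And>x. x \<in> {t..b} \<Longrightarrow> (f4 has_real_derivative f5 x) (at x within {t..b})"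
    and bound: "\<And>x. x \<in> {t..b} \<Longrightarrow> \<bar>f5 x\<bar> \<le> M"
    and x: "x \<in> {t..b}"
  shows "\<bar>trapezoid_remainder f f1 t x + (x - t) ^ 3 / 24 * (f3 x + f3 t)\<bar> \<le> M * (x - t) ^ 5"
proof -
  \<comment> \<open>\<open>?Q x\<close> is the error of the first-order Taylor polynomial of
    \<open>f3\<close> about \<open>x\<close>, evaluated at \<open>t\<close>. Its derivative is
    \<open>(x - t) * f5 x\<close>, so it is quadratic.\<close>
  let ?Q = "\<lambda>x. (x - t) * f4 x - (f3 x - f3 t)"
  have Q: "\<bar>?Q y\<bar> \<le> M * (y - t) ^ 2" if y: "y \<in> {t..b}" for y
  proof -
    have "\<bar>?Q y - ?Q t\<bar> \<le> M * (y - t) ^ Suc 1"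
    proof (rule derivative_power_bound[where f' = "\<lambda>x. (x - t) * f5 x"])
      fix z assume z: "z \<in> {t..b}"
      show "(?Q has_real_derivative (z - t) * f5 z) (at z within {t..b})"
        by (rule derivative_eq_intros d4[OF z] d5[OF z] refl | simp)+
      show "\<bar>(z - t) * f5 z\<bar> \<le> M * (z - t) ^ 1"
        using z mult_left_mono[OF bound[OF z], of "z - t"] by (simp add: abs_mult mult.commute)
    qed (use y in auto)
    then show ?thesis by (simp add: power2_eq_square)
  qed
  \<comment> \<open>\<open>?R1\<close> and \<open>?R2\<close> are the first and second derivatives
    of \<open>?R0\<close>; in the latter all terms with \<open>f3\<close> and \<open>f4\<close>
    combine into \<open>?Q\<close>.\<close>
  let ?R0 = "\<lambda>x. f x - f t - (x - t) / 2 * (f1 x + f1 t) + (x - t) ^ 3 / 24 * (f3 x + f3 t)"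
  let ?R1 = "\<lambda>x. (f1 x - f1 t) / 2 - (x - t) / 2 * f2 x + (x - t) ^ 2 / 8 * (f3 x + f3 t)
    + (x - t) ^ 3 / 24 * f4 x"
  let ?R2 = "\<lambda>x. (x - t) / 4 * ?Q x + (x - t) ^ 3 / 24 * f5 x"
  have R2: "\<bar>?R2 z\<bar> \<le> M * (z - t) ^ 3" if z: "z \<in> {t..b}" for z
  proof -
    have "\<bar>(z - t) / 4 * ?Q z\<bar> = (z - t) / 4 * \<bar>?Q z\<bar>"
      using z by (simp add: abs_mult)
    also have "\<dots> \<le> (z - t) / 4 * (M * (z - t) ^ 2)"
      using z Q[OF z] by (intro mult_left_mono) auto
    finally have 1: "\<bar>(z - t) / 4 * ?Q z\<bar> \<le> M * (z - t) ^ 3 / 4"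
      by (simp add: eval_nat_numeral mult_ac)
    have "\<bar>(z - t) ^ 3 / 24 * f5 z\<bar> = (z - t) ^ 3 / 24 * \<bar>f5 z\<bar>"
      using z by (simp add: abs_mult)
    also have "\<dots> \<le> (z - t) ^ 3 / 24 * M"
      using z bound[OF z] by (intro mult_left_mono) auto
    finally have 2: "\<bar>(z - t) ^ 3 / 24 * f5 z\<bar> \<le> M * (z - t) ^ 3 / 24"
      by (simp add: mult_ac)
    have "0 \<le> M * (z - t) ^ 3"
      using 2 abs_ge_zero[of "(z - t) ^ 3 / 24 * f5 z"] by linarith
    with 1 2 show ?thesis by linarith
  qed
  have R1: "\<bar>?R1 y\<bar> \<le> M * (y - t) ^ 4" if y: "y \<in> {t..b}" for y
  proof -
    have "\<bar>?R1 y - ?R1 t\<bar> \<le> M * (y - t) ^ Suc 3"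
    proof (rule derivative_power_bound[OF _ R2])
      fix z assume z: "z \<in> {t..b}"
      show "(?R1 has_real_derivative ?R2 z) (at z within {t..b})"
        by (rule derivative_eq_intros d2[OF z] d3[OF z] d4[OF z] d5[OF z] refl | simp)+
          (simp add: field_simps eval_nat_numeral)
    qed (use y in auto)
    then show ?thesis by (simp add: eval_nat_numeral)
  qed
  have "\<bar>?R0 x - ?R0 t\<bar> \<le> M * (x - t) ^ Suc 4"
  proof (rule derivative_power_bound[OF _ R1])
    fix z assume z: "z \<in> {t..b}"
    show "(?R0 has_real_derivative ?R1 z) (at z within {t..b})"
      by (rule derivative_eq_intros d1[OF z] d2[OF z] d4[OF z] refl | simp)+ (simp add: field_simps)
  qed (use x in auto)
  then show ?thesis by (simp add: trapezoid_remainder_def eval_nat_numeral)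
qed

section \<open>The scaled average as a perturbed arithmetic mean\<close>

text \<open>The defect of the scaled average against the arithmetic mean, with the factor
  \<open>(\<alpha> - \<beta>)\<^sup>2 / 2\<close> removed. For equal slopes it is
  \<open>\<alpha> / (2 * (\<sigma>\<^sup>2 + \<alpha>\<^sup>2))\<close>, so four times it is
  compared with the sum of two weights
  \<open>\<alpha> / (\<sigma>\<^sup>2 + \<alpha>\<^sup>2)\<close> below.\<close>

definition correction :: "real \<Rightarrow> real \<Rightarrow> real \<Rightarrow> real" where
  "correction \<sigma> \<alpha> \<beta> = (\<alpha> + \<beta>) / (sqrt (\<sigma>\<^sup>2 + \<alpha>\<^sup>2) + sqrt (\<sigma>\<^sup>2 + \<beta>\<^sup>2))\<^sup>2"

text \<open>Clearing denominators gives \<open>(\<alpha> * B + \<beta> * A) / (A + B)\<close>, a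
  mean of the slopes with crossed weights. It differs from the arithmetic mean by a multiple of
  \<open>(\<alpha> - \<beta>) * (A - B)\<close>; expanding by \<open>A + B\<close> produces a
  difference of squares, from which \<sigma> cancels.\<close>

lemma C_scaled_eq:
  assumes "\<sigma> > 0"
  shows "C_scaled \<sigma> \<alpha> \<beta> = (\<alpha> + \<beta>) / 2 - (\<alpha> - \<beta>)\<^sup>2 / 2 * correction \<sigma> \<alpha> \<beta>"
proof -
  define A B where "A = sqrt (\<sigma>\<^sup>2 + \<alpha>\<^sup>2)" and "B = sqrt (\<sigma>\<^sup>2 + \<beta>\<^sup>2)"
  have pos: "A > 0" "B > 0"
    using assms by (auto simp: A_def B_def intro!: add_pos_nonneg)
  have sq: "A\<^sup>2 = \<sigma>\<^sup>2 + \<alpha>\<^sup>2" "B\<^sup>2 = \<sigma>\<^sup>2 + \<beta>\<^sup>2"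
    by (simp_all add: A_def B_def)
  have scale: "sqrt (1 + (x / \<sigma>)\<^sup>2) = sqrt (\<sigma>\<^sup>2 + x\<^sup>2) / \<sigma>" for x
  proof -
    have "1 + (x / \<sigma>)\<^sup>2 = (\<sigma>\<^sup>2 + x\<^sup>2) / \<sigma>\<^sup>2"
      using assms by (simp add: field_simps power2_eq_square)
    then show ?thesis
      using assms by (simp add: real_sqrt_divide)
  qed
  have "C_scaled \<sigma> \<alpha> \<beta> = \<sigma> * ((\<alpha> / A + \<beta> / B) * inverse (\<sigma> / A + \<sigma> / B))"
    using assms by (simp add: C_scaled_def C_avg_def scale A_def[symmetric] B_def[symmetric])
  also have "\<dots> = (\<alpha> * B + \<beta> * A) / (A + B)"
  proof -
    have "\<alpha> / A + \<beta> / B = (\<alpha> * B + \<beta> * A) / (A * B)" "\<sigma> / A + \<sigma> / B = \<sigma> * (A + B) / (A * B)"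
      using pos by (simp_all add: field_simps)
    then show ?thesis using pos assms by simp
  qed
  also have "\<dots> = (\<alpha> + \<beta>) / 2 - (\<alpha> - \<beta>) * ((A - B) * (A + B)) / (2 * (A + B)\<^sup>2)"
    using pos by (simp add: divide_simps power2_eq_square) (simp add: algebra_simps)
  also have "(A - B) * (A + B) = (\<alpha> - \<beta>) * (\<alpha> + \<beta>)"
    using sq by (simp add: power2_eq_square algebra_simps)
  finally show ?thesis
    by (simp add: correction_def A_def B_def power2_eq_square mult_ac)
qed

lemma abs_le_sqrt_sum_squares: "\<bar>\<alpha>\<bar> \<le> sqrt (\<sigma>\<^sup>2 + \<alpha>\<^sup>2)" for \<sigma> \<alpha> :: real
  by (rule real_le_rsqrt) simp

text \<open>The roots are the Euclidean norms of \<open>(\<sigma>, \<alpha>)\<close> and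
  \<open>(\<sigma>, \<beta>)\<close>, so this is the reverse triangle inequality. The Lipschitz
  constant 1 does not depend on \<sigma>, which makes the later bounds uniform in the scale.\<close>

lemma sqrt_sum_squares_diff_le:
  fixes \<sigma> \<alpha> \<beta> :: real
  shows "\<bar>sqrt (\<sigma>\<^sup>2 + \<alpha>\<^sup>2) - sqrt (\<sigma>\<^sup>2 + \<beta>\<^sup>2)\<bar> \<le> \<bar>\<alpha> - \<beta>\<bar>"
  using norm_triangle_ineq3[of "(\<sigma>, \<alpha>)" "(\<sigma>, \<beta>)"] by (simp add: norm_Pair)

text \<open>Since \<open>\<bar>\<alpha> + \<beta>\<bar> \<le> A + B\<close>, the quotient is at most
  \<open>1 / (A + B)\<close>. A lower bound on one root suffices, which fits a scale condition
  imposed only at the left grid point.\<close>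

lemma correction_bound:
  assumes "c > 0" "sqrt (\<sigma>\<^sup>2 + \<alpha>\<^sup>2) \<ge> c"
  shows "\<bar>correction \<sigma> \<alpha> \<beta>\<bar> \<le> 1 / c"
proof -
  define A B where "A = sqrt (\<sigma>\<^sup>2 + \<alpha>\<^sup>2)" and "B = sqrt (\<sigma>\<^sup>2 + \<beta>\<^sup>2)"
  have AB: "\<bar>\<alpha>\<bar> \<le> A" "\<bar>\<beta>\<bar> \<le> B" "A \<ge> c" "B \<ge> 0"
    using assms by (auto simp: A_def B_def abs_le_sqrt_sum_squares)
  have "\<bar>correction \<sigma> \<alpha> \<beta>\<bar> = \<bar>\<alpha> + \<beta>\<bar> / (A + B)\<^sup>2"
    by (simp add: correction_def A_def B_def)
  also have "\<dots> \<le> (A + B) / (A + B)\<^sup>2"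
    using AB by (intro divide_right_mono) auto
  also have "\<dots> = 1 / (A + B)"
    by (simp add: power2_eq_square)
  also have "\<dots> \<le> 1 / c"
    using AB assms by (intro divide_left_mono) auto
  finally show ?thesis .
qed

text \<open>Freezing \<open>\<beta>\<close> at \<open>\<alpha>\<close> costs one power of the slope
  difference: after putting everything over a common denominator, each term of the numerator
  contains \<open>\<beta> - \<alpha>\<close> or \<open>A - B\<close>, and both are at most
  \<open>\<bar>\<alpha> - \<beta>\<bar>\<close> in absolute value.\<close>

lemma correction_expansion_left:
  assumes "c > 0" "sqrt (\<sigma>\<^sup>2 + \<alpha>\<^sup>2) \<ge> c"
  shows "\<bar>4 * correction \<sigma> \<alpha> \<beta> - 2 * \<alpha> / (\<sigma>\<^sup>2 + \<alpha>\<^sup>2)\<bar> \<le> 10 / c\<^sup>2 * \<bar>\<alpha> - \<beta>\<bar>"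
proof -
  define A B where "A = sqrt (\<sigma>\<^sup>2 + \<alpha>\<^sup>2)" and "B = sqrt (\<sigma>\<^sup>2 + \<beta>\<^sup>2)"
  have "A \<ge> c" using assms by (simp add: A_def)
  with assms have "A > 0" by linarith
  then have AB: "\<bar>\<alpha>\<bar> \<le> A" "A \<ge> c" "A > 0" "B \<ge> 0" "\<bar>A - B\<bar> \<le> \<bar>\<alpha> - \<beta>\<bar>"
    using assms by (auto simp: A_def B_def abs_le_sqrt_sum_squares sqrt_sum_squares_diff_le)
  have sq: "\<sigma>\<^sup>2 + \<alpha>\<^sup>2 = A\<^sup>2"
    by (simp add: A_def)
  have "4 * correction \<sigma> \<alpha> \<beta> - 2 * \<alpha> / (\<sigma>\<^sup>2 + \<alpha>\<^sup>2) = 4 * (\<alpha> + \<beta>) / (A + B)\<^sup>2 - 2 * \<alpha> / A\<^sup>2"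
    unfolding correction_def A_def[symmetric] B_def[symmetric] unfolding sq by simp
  \<comment> \<open>Adding and subtracting \<open>8 * \<alpha> * A\<^sup>2\<close> leaves
    \<open>4 * A\<^sup>2 - (A + B)\<^sup>2\<close>, which factors as
    \<open>(A - B) * (3 * A + B)\<close>.\<close>
  also have "\<dots> = (4 * (\<beta> - \<alpha>) * A\<^sup>2 + 2 * \<alpha> * ((A - B) * (3 * A + B))) / (A\<^sup>2 * (A + B)\<^sup>2)"
  proof -
    have "(A + B)\<^sup>2 \<noteq> 0" "A\<^sup>2 \<noteq> 0" using AB by auto
    then have "4 * (\<alpha> + \<beta>) / (A + B)\<^sup>2 - 2 * \<alpha> / A\<^sup>2
        = (4 * (\<alpha> + \<beta>) * A\<^sup>2 - 2 * \<alpha> * (A + B)\<^sup>2) / (A\<^sup>2 * (A + B)\<^sup>2)"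
      by (simp add: field_simps)
    then show ?thesis by (simp add: power2_eq_square algebra_simps)
  qed
  finally have eq: "4 * correction \<sigma> \<alpha> \<beta> - 2 * \<alpha> / (\<sigma>\<^sup>2 + \<alpha>\<^sup>2) = \<dots>" .
  have "\<bar>4 * (\<beta> - \<alpha>) * A\<^sup>2 + 2 * \<alpha> * ((A - B) * (3 * A + B))\<bar>
      \<le> 4 * \<bar>\<alpha> - \<beta>\<bar> * A\<^sup>2 + 2 * \<bar>\<alpha>\<bar> * (\<bar>A - B\<bar> * (3 * A + B))"
  proof -
    have "\<bar>4 * (\<beta> - \<alpha>) * A\<^sup>2\<bar> = 4 * \<bar>\<alpha> - \<beta>\<bar> * A\<^sup>2"
      by (simp only: abs_mult abs_minus_commute[of \<beta> \<alpha>]) simp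
    moreover have "\<bar>2 * \<alpha> * ((A - B) * (3 * A + B))\<bar> = 2 * \<bar>\<alpha>\<bar> * (\<bar>A - B\<bar> * (3 * A + B))"
      using AB by (simp add: abs_mult)
    ultimately show ?thesis
      using abs_triangle_ineq by metis
  qed
  also have "\<dots> \<le> 4 * \<bar>\<alpha> - \<beta>\<bar> * A\<^sup>2 + 2 * A * (\<bar>\<alpha> - \<beta>\<bar> * (3 * A + B))"
    using AB by (intro add_left_mono mult_mono mult_left_mono mult_right_mono) auto
  \<comment> \<open>The constant 10 arises here: 4 from the first summand and 6 from the
    second.\<close>
  also have "\<dots> = \<bar>\<alpha> - \<beta>\<bar> * A * (10 * A + 2 * B)"
    by (simp add: power2_eq_square algebra_simps)
  also have "\<dots> \<le> \<bar>\<alpha> - \<beta>\<bar> * A * (10 * (A + B))"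
    using AB by (intro mult_left_mono) auto
  finally have "\<bar>4 * correction \<sigma> \<alpha> \<beta> - 2 * \<alpha> / (\<sigma>\<^sup>2 + \<alpha>\<^sup>2)\<bar>
      \<le> \<bar>\<alpha> - \<beta>\<bar> * A * (10 * (A + B)) / (A\<^sup>2 * (A + B)\<^sup>2)"
    unfolding eq by (simp add: divide_right_mono)
  also have "\<dots> = 10 * \<bar>\<alpha> - \<beta>\<bar> / (A * (A + B))"
  proof -
    have "A + B \<noteq> 0" "A \<noteq> 0" using AB by auto
    then show ?thesis by (simp only: power2_eq_square) (simp add: divide_simps)
  qed
  also have "\<dots> \<le> 10 * \<bar>\<alpha> - \<beta>\<bar> / c\<^sup>2"
    using AB assms by (intro divide_left_mono) (auto simp: power2_eq_square intro!: mult_mono mult_pos_pos)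
  finally show ?thesis by simp
qed

text \<open>With the weights taken at both endpoints, the terms linear in the slope difference
  cancel and every remaining term carries \<open>(\<alpha> - \<beta>)\<^sup>2\<close> or
  \<open>(A - B)\<^sup>2\<close>.\<close>

lemma correction_expansion_symmetric:
  assumes "c > 0" "sqrt (\<sigma>\<^sup>2 + \<alpha>\<^sup>2) \<ge> c" "sqrt (\<sigma>\<^sup>2 + \<beta>\<^sup>2) \<ge> c"
  shows "\<bar>4 * correction \<sigma> \<alpha> \<beta> - (\<alpha> / (\<sigma>\<^sup>2 + \<alpha>\<^sup>2) + \<beta> / (\<sigma>\<^sup>2 + \<beta>\<^sup>2))\<bar> \<le> 4 / c ^ 3 * (\<alpha> - \<beta>)\<^sup>2"
proof -
  define A B where "A = sqrt (\<sigma>\<^sup>2 + \<alpha>\<^sup>2)" and "B = sqrt (\<sigma>\<^sup>2 + \<beta>\<^sup>2)"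
  have "A \<ge> c" "B \<ge> c" using assms by (simp_all add: A_def B_def)
  with assms have "A > 0" "B > 0" by linarith+
  then have AB: "\<bar>\<alpha>\<bar> \<le> A" "\<bar>\<beta>\<bar> \<le> B" "A \<ge> c" "B \<ge> c" "A > 0" "B > 0" "\<bar>A - B\<bar> \<le> \<bar>\<alpha> - \<beta>\<bar>"
    using assms by (auto simp: A_def B_def abs_le_sqrt_sum_squares sqrt_sum_squares_diff_le)
  have sq: "\<sigma>\<^sup>2 + \<alpha>\<^sup>2 = A\<^sup>2" "\<sigma>\<^sup>2 + \<beta>\<^sup>2 = B\<^sup>2"
    by (simp_all add: A_def B_def)
  have sqd: "A\<^sup>2 - B\<^sup>2 = \<alpha>\<^sup>2 - \<beta>\<^sup>2"
    by (simp flip: sq)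
  \<comment> \<open>\<open>Y\<close> is the covariance term from splitting
    \<open>\<alpha> / A\<^sup>2 + \<beta> / B\<^sup>2\<close> into a product of averages and a
    product of differences. \<open>X\<close> compares the mean of \<open>1 / A\<^sup>2\<close> and
    \<open>1 / B\<^sup>2\<close> with the inverse square of the mean of \<open>A\<close> and
    \<open>B\<close>.\<close>
  define X Y where "X = (\<alpha> + \<beta>) * ((A - B)\<^sup>2 * (A\<^sup>2 + B\<^sup>2 + 4 * A * B)) / (2 * A\<^sup>2 * B\<^sup>2 * (A + B)\<^sup>2)"
    and "Y = (\<alpha> - \<beta>)\<^sup>2 * (\<alpha> + \<beta>) / (2 * A\<^sup>2 * B\<^sup>2)"
  have "4 * correction \<sigma> \<alpha> \<beta> - (\<alpha> / (\<sigma>\<^sup>2 + \<alpha>\<^sup>2) + \<beta> / (\<sigma>\<^sup>2 + \<beta>\<^sup>2))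
      = 4 * (\<alpha> + \<beta>) / (A + B)\<^sup>2 - (\<alpha> / A\<^sup>2 + \<beta> / B\<^sup>2)"
    unfolding correction_def A_def[symmetric] B_def[symmetric] unfolding sq by simp
  also have "\<dots> = Y - X"
  proof -
    have nz: "(A + B)\<^sup>2 \<noteq> 0" "A\<^sup>2 \<noteq> 0" "B\<^sup>2 \<noteq> 0" using AB by auto
    have "\<alpha> / A\<^sup>2 + \<beta> / B\<^sup>2 = (\<alpha> + \<beta>) / 2 * (1 / A\<^sup>2 + 1 / B\<^sup>2) - (\<alpha> - \<beta>) * (A\<^sup>2 - B\<^sup>2) / (2 * A\<^sup>2 * B\<^sup>2)"
      using nz by (simp add: field_simps)
    also have "(\<alpha> - \<beta>) * (A\<^sup>2 - B\<^sup>2) / (2 * A\<^sup>2 * B\<^sup>2) = Y"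
      unfolding sqd Y_def by (simp add: power2_eq_square algebra_simps)
    finally have 1: "\<alpha> / A\<^sup>2 + \<beta> / B\<^sup>2 = (\<alpha> + \<beta>) / 2 * (1 / A\<^sup>2 + 1 / B\<^sup>2) - Y" .
    have "(\<alpha> + \<beta>) / 2 * (1 / A\<^sup>2 + 1 / B\<^sup>2) - 4 * (\<alpha> + \<beta>) / (A + B)\<^sup>2
        = (\<alpha> + \<beta>) * ((A\<^sup>2 + B\<^sup>2) * (A + B)\<^sup>2 - 8 * A\<^sup>2 * B\<^sup>2) / (2 * A\<^sup>2 * B\<^sup>2 * (A + B)\<^sup>2)"
      using nz by (simp add: field_simps)
    also have "(A\<^sup>2 + B\<^sup>2) * (A + B)\<^sup>2 - 8 * A\<^sup>2 * B\<^sup>2 = (A - B)\<^sup>2 * (A\<^sup>2 + B\<^sup>2 + 4 * A * B)"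
      by (simp add: power2_eq_square algebra_simps)
    finally show ?thesis using 1 by (simp add: X_def)
  qed
  finally have eq: "4 * correction \<sigma> \<alpha> \<beta> - (\<alpha> / (\<sigma>\<^sup>2 + \<alpha>\<^sup>2) + \<beta> / (\<sigma>\<^sup>2 + \<beta>\<^sup>2)) = Y - X" .
  have ab: "\<bar>\<alpha> + \<beta>\<bar> \<le> A + B" using AB by linarith
  \<comment> \<open>A common bound for \<open>X\<close> and \<open>Y\<close>. It has degree -3 in
    the roots, which accounts for \<open>c ^ 3\<close>; it is at most
    \<open>2 / c ^ 3 * (\<alpha> - \<beta>)\<^sup>2\<close>, so the two together give the constant
    4.\<close>
  define Z where "Z = (A + B) * (\<alpha> - \<beta>)\<^sup>2 / (A\<^sup>2 * B\<^sup>2)"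
  have "\<bar>Y\<bar> = (\<alpha> - \<beta>)\<^sup>2 * \<bar>\<alpha> + \<beta>\<bar> / (2 * A\<^sup>2 * B\<^sup>2)"
    by (simp add: Y_def abs_mult)
  also have "\<dots> \<le> (\<alpha> - \<beta>)\<^sup>2 * (A + B) / (A\<^sup>2 * B\<^sup>2)"
    using AB ab by (intro frac_le mult_left_mono) auto
  finally have Y: "\<bar>Y\<bar> \<le> Z" by (simp add: Z_def mult_ac)
  have "\<bar>X\<bar> = \<bar>\<alpha> + \<beta>\<bar> * ((A - B)\<^sup>2 * (A\<^sup>2 + B\<^sup>2 + 4 * A * B)) / (2 * A\<^sup>2 * B\<^sup>2 * (A + B)\<^sup>2)"
    using AB by (simp add: X_def abs_mult)
  also have "\<dots> \<le> (A + B) * ((\<alpha> - \<beta>)\<^sup>2 * (2 * (A + B)\<^sup>2)) / (2 * A\<^sup>2 * B\<^sup>2 * (A + B)\<^sup>2)"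
  proof (intro divide_right_mono mult_mono ab)
    show "(A - B)\<^sup>2 \<le> (\<alpha> - \<beta>)\<^sup>2" using AB by (simp add: abs_le_square_iff)
    show "A\<^sup>2 + B\<^sup>2 + 4 * A * B \<le> 2 * (A + B)\<^sup>2"
      by (simp add: power2_eq_square algebra_simps)
  qed (use AB in auto)
  also have "\<dots> = Z" using AB by (simp add: Z_def)
  finally have X: "\<bar>X\<bar> \<le> Z" .
  have "Z = (\<alpha> - \<beta>)\<^sup>2 * (1 / (A * B\<^sup>2) + 1 / (A\<^sup>2 * B))"
    using AB by (simp add: Z_def field_simps power2_eq_square)
  also have "\<dots> \<le> (\<alpha> - \<beta>)\<^sup>2 * (1 / c ^ 3 + 1 / c ^ 3)"
  proof (intro mult_left_mono add_mono divide_left_mono)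
    have "c * c\<^sup>2 \<le> A * B\<^sup>2" "c\<^sup>2 * c \<le> A\<^sup>2 * B"
      using AB assms by (auto intro!: mult_mono power_mono)
    then show "c ^ 3 \<le> A * B\<^sup>2" "c ^ 3 \<le> A\<^sup>2 * B"
      by (simp_all add: eval_nat_numeral mult_ac)
  qed (use AB assms in auto)
  finally have "2 * Z \<le> 4 / c ^ 3 * (\<alpha> - \<beta>)\<^sup>2" by simp
  with X Y show ?thesis unfolding eq by linarith
qed

lemma correction_commute: "correction \<sigma> \<alpha> \<beta> = correction \<sigma> \<beta> \<alpha>"
  by (simp add: correction_def add.commute)

text \<open>This weight multiplies three times the squared second derivative in the curvature
  condition; its size follows from \<open>\<bar>\<alpha>\<bar> \<le> sqrt (\<sigma>\<^sup>2 +
  \<alpha>\<^sup>2)\<close>.\<close>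

lemma weight_bound:
  assumes "c > 0" "sqrt (\<sigma>\<^sup>2 + \<alpha>\<^sup>2) \<ge> c"
  shows "\<bar>\<alpha> / (\<sigma>\<^sup>2 + \<alpha>\<^sup>2)\<bar> \<le> 1 / c"
proof -
  have "\<bar>\<alpha> / (\<sigma>\<^sup>2 + \<alpha>\<^sup>2)\<bar> = \<bar>\<alpha>\<bar> / (sqrt (\<sigma>\<^sup>2 + \<alpha>\<^sup>2))\<^sup>2"
    by simp
  also have "\<dots> \<le> sqrt (\<sigma>\<^sup>2 + \<alpha>\<^sup>2) / (sqrt (\<sigma>\<^sup>2 + \<alpha>\<^sup>2))\<^sup>2"
    by (intro divide_right_mono abs_le_sqrt_sum_squares) simp
  also have "\<dots> = 1 / sqrt (\<sigma>\<^sup>2 + \<alpha>\<^sup>2)"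
    by (simp add: sqrt_divide_self_eq inverse_eq_divide)
  also have "\<dots> \<le> 1 / c"
    using assms by (intro divide_left_mono mult_pos_pos) linarith+
  finally show ?thesis .
qed

section \<open>Speed and curvature of the scaled graph\<close>

lemma graph_speed_eq:
  assumes u: "(u has_real_derivative u') (at t within {a..b})"
    and "a < b" "t \<in> {a..b}" "\<sigma> > 0"
  shows "graph_speed {a..b} \<sigma> u t = sqrt (\<sigma>\<^sup>2 + u'\<^sup>2) / \<sigma>"
proof -
  have "((\<lambda>t. u t / \<sigma>) has_vector_derivative u' / \<sigma>) (at t within {a..b})"
    using DERIV_cdivide[OF u] by (simp add: has_real_derivative_iff_has_vector_derivative)
  then have "(scaled_graph \<sigma> u has_vector_derivative (1, u' / \<sigma>)) (at t within {a..b})"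
    unfolding scaled_graph_def by (intro has_vector_derivative_Pair has_vector_derivative_id) simp
  then have "graph_speed {a..b} \<sigma> u t = sqrt (1 + (u' / \<sigma>)\<^sup>2)"
    using assms by (simp add: graph_speed_def deriv_on_eqI norm_Pair power_divide)
  also have "1 + (u' / \<sigma>)\<^sup>2 = (\<sigma>\<^sup>2 + u'\<^sup>2) / \<sigma>\<^sup>2"
    using assms by (simp add: field_simps)
  finally show ?thesis
    using assms by (simp add: real_sqrt_divide)
qed

lemma powr_three_halves: "x powr (3 / 2) = sqrt x ^ 3" if "x \<ge> 0" for x :: real
proof -
  have "x powr (3 / 2) = (x powr (1 / 2)) powr 3"
    by (simp add: powr_powr)
  then show ?thesis
    using that by (simp add: powr_half_sqrt powr_numeral)
qed

text \<open>The quotient rule, arranged so that the prefactor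
  \<open>\<sigma>\<^sup>2 / sqrt W ^ 3\<close> is positive: vanishing of the curvature derivative is
  then vanishing of the parenthesis.\<close>

lemma curvature_deriv_eq:
  fixes u u1 u2 u3 :: "real \<Rightarrow> real"
  assumes d1: "\<And>x. x \<in> {a..b} \<Longrightarrow> (u has_real_derivative u1 x) (at x within {a..b})"
    and d2: "\<And>x. x \<in> {a..b} \<Longrightarrow> (u1 has_real_derivative u2 x) (at x within {a..b})"
    and d3: "\<And>x. x \<in> {a..b} \<Longrightarrow> (u2 has_real_derivative u3 x) (at x within {a..b})"
    and ab: "a < b" and t: "t \<in> {a..b}" and \<sigma>: "\<sigma> > 0"
  defines "W \<equiv> \<sigma>\<^sup>2 + (u1 t)\<^sup>2"
  shows "curvature_deriv {a..b} \<sigma> u t = \<sigma>\<^sup>2 * (u3 t - 3 * u1 t * (u2 t)\<^sup>2 / W) / sqrt W ^ 3"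
proof -
  let ?D = "\<lambda>x. sqrt (\<sigma>\<^sup>2 + (u1 x)\<^sup>2)"
  have pos: "\<sigma>\<^sup>2 + (u1 x)\<^sup>2 > 0" for x
    using \<sigma> by (intro add_pos_nonneg) auto
  have u1: "deriv_on {a..b} u x = u1 x" if "x \<in> {a..b}" for x
    using d1 ab that by (intro deriv_on_real_eqI) auto
  have u2: "deriv_on {a..b} (deriv_on {a..b} u) x = u2 x" if "x \<in> {a..b}" for x
  proof (rule deriv_on_real_eqI[OF _ ab that])
    \<comment> \<open>\<open>deriv_on {a..b} u\<close> is known to agree with \<open>u1\<close> only
      on the interval, so the derivative is transferred within it. The radius 1 is
      arbitrary.\<close>
    show "(deriv_on {a..b} u has_real_derivative u2 x) (at x within {a..b})"
      using has_field_derivative_transform_within[OF d2[OF that], of 1] u1 that by auto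
  qed
  have \<kappa>: "signed_curvature {a..b} \<sigma> u x = \<sigma>\<^sup>2 * u2 x / ?D x ^ 3" if "x \<in> {a..b}" for x
    using that pos[of x] by (simp add: signed_curvature_def u1 u2 powr_three_halves)
  have Wpos: "W > 0" using pos by (simp add: W_def)
  have D: "(?D has_real_derivative u1 t * u2 t / sqrt W) (at t within {a..b})"
  proof -
    have "((\<lambda>x. \<sigma>\<^sup>2 + (u1 x)\<^sup>2) has_real_derivative 2 * u1 t * u2 t) (at t within {a..b})"
      by (auto intro!: derivative_eq_intros d2[OF t])
    from DERIV_chain2[OF DERIV_real_sqrt[OF pos] this] show ?thesis
      by (simp add: W_def field_simps)
  qed
  \<comment> \<open>Treating the root as an atom makes the quotient rule an identity of rational
    functions in \<open>w\<close>.\<close>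
  define w where "w = sqrt W"
  have w: "w \<noteq> 0" "W = w\<^sup>2" using Wpos by (simp_all add: w_def)
  have Dt: "?D t = w" by (simp add: w_def W_def)
  have "((\<lambda>x. \<sigma>\<^sup>2 * u2 x / ?D x ^ 3) has_real_derivative
      (\<sigma>\<^sup>2 * u3 t * w ^ 3 - \<sigma>\<^sup>2 * u2 t * (3 * (u1 t * u2 t / w * w\<^sup>2))) / (w ^ 3 * w ^ 3))
      (at t within {a..b})"
    using DERIV_divide[OF DERIV_cmult[OF d3[OF t], of "\<sigma>\<^sup>2"] DERIV_power[OF D, of 3]] w(1)
    unfolding Dt w_def[symmetric] by (simp add: numeral_2_eq_2)
  also have "(\<sigma>\<^sup>2 * u3 t * w ^ 3 - \<sigma>\<^sup>2 * u2 t * (3 * (u1 t * u2 t / w * w\<^sup>2))) / (w ^ 3 * w ^ 3)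
      = \<sigma>\<^sup>2 * (u3 t - 3 * u1 t * (u2 t)\<^sup>2 / W) / sqrt W ^ 3"
    unfolding w_def[symmetric] unfolding w(2)
    using w(1) by (simp add: field_simps eval_nat_numeral)
  finally have "((\<lambda>x. \<sigma>\<^sup>2 * u2 x / ?D x ^ 3) has_real_derivative
      \<sigma>\<^sup>2 * (u3 t - 3 * u1 t * (u2 t)\<^sup>2 / W) / sqrt W ^ 3) (at t within {a..b})" .
  then have "(signed_curvature {a..b} \<sigma> u has_real_derivative
      \<sigma>\<^sup>2 * (u3 t - 3 * u1 t * (u2 t)\<^sup>2 / W) / sqrt W ^ 3) (at t within {a..b})"
    by (rule has_field_derivative_transform_within[of _ _ _ _ 1]) (use \<kappa> t in auto)
  then show ?thesis
    unfolding curvature_deriv_def using ab t by (intro deriv_on_real_eqI)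
qed

section \<open>Error of a single step\<close>

text \<open>Along the solution \<open>F\<close> equals the slope \<open>u1\<close>, so the residual
  involves \<open>u\<close> alone. The arithmetic mean joins the difference quotient to form the
  trapezoidal remainder, and the defect enters with a plus sign.\<close>

lemma SE_lte_eq:
  assumes "h > 0" "\<sigma> n > 0"
    and t: "t = grid t0 h n"
    and F: "F (t, u t) = u1 t" "F (t + h, u (t + h)) = u1 (t + h)"
  shows "SE_lte F u t0 h \<sigma> n = trapezoid_remainder u u1 t (t + h) / h
    + (u1 t - u1 (t + h))\<^sup>2 / 2 * correction (\<sigma> n) (u1 t) (u1 (t + h))"
proof -
  have "grid t0 h (n + 1) = t + h"
    by (simp add: t grid_def algebra_simps)
  moreover have "C_scaled (\<sigma> n) (u1 (t + h)) (u1 t)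
      = (u1 (t + h) + u1 t) / 2 - (u1 t - u1 (t + h))\<^sup>2 / 2 * correction (\<sigma> n) (u1 t) (u1 (t + h))"
    by (subst C_scaled_eq[OF assms(2)], subst correction_commute, subst power2_commute, rule refl)
  moreover have "trapezoid_remainder u u1 t (t + h) / h = (u (t + h) - u t) / h - (u1 (t + h) + u1 t) / 2"
    using assms(1) by (simp add: trapezoid_remainder_def field_simps)
  ultimately show ?thesis
    unfolding SE_lte_def t[symmetric] by (simp add: F)
qed

text \<open>The trapezoidal remainder is cubic before division by \<open>h\<close>, and the squared
  slope difference is at most \<open>(M * h)\<^sup>2\<close> while the correction is at most
  \<open>1 / c\<close>.\<close>

lemma SE_order_2:
  fixes u u1 u2 u3 :: "real \<Rightarrow> real"
  assumes d1: "\<And>x. x \<in> {t..t+h} \<Longrightarrow> (u has_real_derivative u1 x) (at x within {t..t+h})"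
    and d2: "\<And>x. x \<in> {t..t+h} \<Longrightarrow> (u1 has_real_derivative u2 x) (at x within {t..t+h})"
    and d3: "\<And>x. x \<in> {t..t+h} \<Longrightarrow> (u2 has_real_derivative u3 x) (at x within {t..t+h})"
    and bound: "\<And>x. x \<in> {t..t+h} \<Longrightarrow> \<bar>u2 x\<bar> \<le> M" "\<And>x. x \<in> {t..t+h} \<Longrightarrow> \<bar>u3 x\<bar> \<le> M"
    and h: "h > 0" and c: "c > 0" "sqrt (\<sigma>\<^sup>2 + (u1 t)\<^sup>2) \<ge> c"
  shows "\<bar>trapezoid_remainder u u1 t (t + h) / h
    + (u1 t - u1 (t + h))\<^sup>2 / 2 * correction \<sigma> (u1 t) (u1 (t + h))\<bar> \<le> (M + M\<^sup>2 / c) * h ^ 2"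
proof -
  let ?d = "u1 t - u1 (t + h)"
  have "\<bar>trapezoid_remainder u u1 t (t + h)\<bar> \<le> M * h ^ 3"
    using trapezoid_bound[OF d1 d2 d3 bound(2), of "t + h"] h by simp
  then have R: "\<bar>trapezoid_remainder u u1 t (t + h) / h\<bar> \<le> M * h ^ 2"
    using h by (simp add: divide_simps eval_nat_numeral mult_ac)
  have "\<bar>?d\<bar> \<le> M * h"
    using derivative_power_bound[OF d2, of M 0 "t + h"] bound(1) h by (simp add: abs_minus_commute)
  then have "?d\<^sup>2 \<le> (M * h)\<^sup>2"
    using power_mono[of "\<bar>?d\<bar>" "M * h" 2] by simp
  then have "?d\<^sup>2 / 2 \<le> (M * h)\<^sup>2"
    using zero_le_power2[of "M * h"] by linarith
  then have "\<bar>?d\<^sup>2 / 2 * correction \<sigma> (u1 t) (u1 (t + h))\<bar> \<le> (M * h)\<^sup>2 * (1 / c)"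
    unfolding abs_mult using correction_bound[OF c, of "u1 (t + h)"] by (intro mult_mono) auto
  with R have "\<bar>trapezoid_remainder u u1 t (t + h) / h + ?d\<^sup>2 / 2 * correction \<sigma> (u1 t) (u1 (t + h))\<bar>
      \<le> M * h ^ 2 + (M * h)\<^sup>2 * (1 / c)"
    by linarith
  then show ?thesis by (simp add: algebra_simps power_mult_distrib)
qed

lemma taylor_order_2:
  fixes f f1 f2 :: "real \<Rightarrow> real"
  assumes d1: "\<And>x. x \<in> {t..b} \<Longrightarrow> (f has_real_derivative f1 x) (at x within {t..b})"
    and d2: "\<And>x. x \<in> {t..b} \<Longrightarrow> (f1 has_real_derivative f2 x) (at x within {t..b})"
    and bound: "\<And>x. x \<in> {t..b} \<Longrightarrow> \<bar>f2 x\<bar> \<le> M"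
    and x: "x \<in> {t..b}"
  shows "\<bar>f x - f t - (x - t) * f1 t\<bar> \<le> M * (x - t) ^ 2"
proof -
  let ?g = "\<lambda>x. f x - (x - t) * f1 t"
  have "\<bar>?g x - ?g t\<bar> \<le> M * (x - t) ^ Suc 1"
  proof (rule derivative_power_bound[where f' = "\<lambda>x. f1 x - f1 t"])
    fix z assume z: "z \<in> {t..b}"
    show "(?g has_real_derivative f1 z - f1 t) (at z within {t..b})"
      by (rule derivative_eq_intros d1[OF z] refl | simp)+
    show "\<bar>f1 z - f1 t\<bar> \<le> M * (z - t) ^ 1"
      using derivative_power_bound[OF d2, of M 0 z] bound z by simp
  qed (use x in auto)
  then show ?thesis by (simp add: power2_eq_square algebra_simps)
qed

text \<open>The trapezoidal part contributes \<open>- h\<^sup>2 / 12 * u3 t\<close> and the defect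
  contributes \<open>h\<^sup>2 / 4 * (u2 t)\<^sup>2 * r\<close> to leading order;
  \<open>cond\<close> makes them cancel. What remains is the error of replacing the correction by
  its value at equal slopes and the slope difference by its linear part.\<close>

lemma SE_order_3:
  fixes u u1 u2 u3 u4 :: "real \<Rightarrow> real"
  assumes d1: "\<And>x. x \<in> {t..t+h} \<Longrightarrow> (u has_real_derivative u1 x) (at x within {t..t+h})"
    and d2: "\<And>x. x \<in> {t..t+h} \<Longrightarrow> (u1 has_real_derivative u2 x) (at x within {t..t+h})"
    and d3: "\<And>x. x \<in> {t..t+h} \<Longrightarrow> (u2 has_real_derivative u3 x) (at x within {t..t+h})"
    and d4: "\<And>x. x \<in> {t..t+h} \<Longrightarrow> (u3 has_real_derivative u4 x) (at x within {t..t+h})"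
    and bound: "\<And>x. x \<in> {t..t+h} \<Longrightarrow> \<bar>u2 x\<bar> \<le> M" "\<And>x. x \<in> {t..t+h} \<Longrightarrow> \<bar>u3 x\<bar> \<le> M"
      "\<And>x. x \<in> {t..t+h} \<Longrightarrow> \<bar>u4 x\<bar> \<le> M"
    and h: "h > 0" and c: "c > 0" "sqrt (\<sigma>\<^sup>2 + (u1 t)\<^sup>2) \<ge> c"
    and cond: "u3 t = 3 * u1 t * (u2 t)\<^sup>2 / (\<sigma>\<^sup>2 + (u1 t)\<^sup>2)"
  shows "\<bar>trapezoid_remainder u u1 t (t + h) / h
    + (u1 t - u1 (t + h))\<^sup>2 / 2 * correction \<sigma> (u1 t) (u1 (t + h))\<bar>
    \<le> (M + (10 * M ^ 3 / c\<^sup>2 + 4 * M\<^sup>2 / c) / 8) * h ^ 3"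
proof -
  define d G r where "d = u1 t - u1 (t + h)" and "G = correction \<sigma> (u1 t) (u1 (t + h))"
    and "r = u1 t / (\<sigma>\<^sup>2 + (u1 t)\<^sup>2)"
  have M: "M \<ge> 0" using bound(1)[of t] h by simp
  have "\<bar>trapezoid_remainder u u1 t (t + h) + h ^ 3 / 12 * u3 t\<bar> \<le> M * h ^ 4"
    using trapezoid_expansion_left[OF d1 d2 d3 d4 bound(3), of "t + h"] h by simp
  then have R: "\<bar>(trapezoid_remainder u u1 t (t + h) + h ^ 3 / 12 * u3 t) / h\<bar> \<le> M * h ^ 3"
    using h by (simp add: abs_divide divide_simps eval_nat_numeral mult_ac)
  have d: "\<bar>d\<bar> \<le> M * h"
    using derivative_power_bound[OF d2, of M 0 "t + h"] bound(1) h
    by (simp add: d_def abs_minus_commute)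
  have dd: "\<bar>- d - h * u2 t\<bar> \<le> M * h ^ 2"
    using taylor_order_2[OF d2 d3 bound(2), of "t + h"] h by (simp add: d_def)
  have a': "\<bar>h * u2 t\<bar> \<le> M * h"
    using bound(1)[of t] h by (simp add: abs_mult mult.commute)
  \<comment> \<open>Difference of squares: the first factor is a Taylor error of order two, the
    second has order one.\<close>
  have "\<bar>(- d - h * u2 t) * (- d + h * u2 t)\<bar> \<le> (M * h ^ 2) * (2 * (M * h))"
    unfolding abs_mult using dd d a' M h by (intro mult_mono) auto
  also have "(- d - h * u2 t) * (- d + h * u2 t) = d\<^sup>2 - (h * u2 t)\<^sup>2"
    by (simp add: power2_eq_square algebra_simps)
  finally have "\<bar>d\<^sup>2 - (h * u2 t)\<^sup>2\<bar> \<le> (M * h ^ 2) * (2 * (M * h))" .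
  then have "\<bar>(d\<^sup>2 - (h * u2 t)\<^sup>2) * (2 * r)\<bar> \<le> (M * h ^ 2) * (2 * (M * h)) * (2 * (1 / c))"
    unfolding abs_mult using weight_bound[OF c] M h by (intro mult_mono) (auto simp: r_def)
  then have 1: "\<bar>(d\<^sup>2 - (h * u2 t)\<^sup>2) * (2 * r)\<bar> \<le> 4 * M\<^sup>2 / c * h ^ 3"
    by (simp add: eval_nat_numeral mult_ac)
  have "\<bar>4 * G - 2 * r\<bar> \<le> 10 / c\<^sup>2 * \<bar>d\<bar>"
    using correction_expansion_left[OF c] by (simp add: G_def r_def d_def)
  also have "\<dots> \<le> 10 / c\<^sup>2 * (M * h)"
    using d by (intro mult_left_mono) auto
  finally have "\<bar>d * d * (4 * G - 2 * r)\<bar> \<le> (M * h) * (M * h) * (10 / c\<^sup>2 * (M * h))"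
    unfolding abs_mult using d M h by (intro mult_mono) auto
  then have 2: "\<bar>d\<^sup>2 * (4 * G - 2 * r)\<bar> \<le> 10 * M ^ 3 / c\<^sup>2 * h ^ 3"
    by (simp add: eval_nat_numeral mult_ac)
  have u3: "u3 t = 3 * (u2 t)\<^sup>2 * r"
    by (simp add: cond r_def)
  have "trapezoid_remainder u u1 t (t + h) / h + d\<^sup>2 / 2 * G
    = (trapezoid_remainder u u1 t (t + h) + h ^ 3 / 12 * u3 t) / h
      + (d\<^sup>2 * (4 * G - 2 * r) + (d\<^sup>2 - (h * u2 t)\<^sup>2) * (2 * r)) / 8"
  proof -
    have "(trapezoid_remainder u u1 t (t + h) + h ^ 3 / 12 * u3 t) / h
        = trapezoid_remainder u u1 t (t + h) / h + h\<^sup>2 / 12 * u3 t"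
      using h by (simp add: add_divide_distrib eval_nat_numeral)
    moreover have "d\<^sup>2 / 2 * G = h\<^sup>2 / 12 * (3 * (u2 t)\<^sup>2 * r)
      + (d\<^sup>2 * (4 * G - 2 * r) + (d\<^sup>2 - (h * u2 t)\<^sup>2) * (2 * r)) / 8"
      by (simp add: field_simps power2_eq_square)
    ultimately show ?thesis
      unfolding u3 by linarith
  qed
  \<comment> \<open>The triangle inequality is stated for arbitrary reals so that linear arithmetic
    sees atoms.\<close>
  moreover have "\<bar>x + (y + z) / 8\<bar> \<le> x' + (y' + z') / 8"
    if "\<bar>x\<bar> \<le> x'" "\<bar>y\<bar> \<le> y'" "\<bar>z\<bar> \<le> z'" for x y z x' y' z' :: real
    using that unfolding add_divide_distrib diff_divide_distrib by linarith
  note this[OF R 2 1]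
  ultimately have "\<bar>trapezoid_remainder u u1 t (t + h) / h + d\<^sup>2 / 2 * G\<bar>
    \<le> M * h ^ 3 + (10 * M ^ 3 / c\<^sup>2 * h ^ 3 + 4 * M\<^sup>2 / c * h ^ 3) / 8"
    by simp
  then show ?thesis
    unfolding d_def G_def by (simp add: algebra_simps)
qed

text \<open>All expansions are symmetric in the two endpoints, so after cancellation by
  \<open>cond\<close> the leftovers are of order four. Requiring \<open>2 * c\<close> on the left
  and \<open>M * h \<le> c\<close> provides the lower bound \<open>c\<close> at both
  endpoints.\<close>

lemma SE_order_4:
  fixes u u1 u2 u3 u4 u5 :: "real \<Rightarrow> real"
  assumes d1: "\<And>x. x \<in> {t..t+h} \<Longrightarrow> (u has_real_derivative u1 x) (at x within {t..t+h})"
    and d2: "\<And>x. x \<in> {t..t+h} \<Longrightarrow> (u1 has_real_derivative u2 x) (at x within {t..t+h})"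
    and d3: "\<And>x. x \<in> {t..t+h} \<Longrightarrow> (u2 has_real_derivative u3 x) (at x within {t..t+h})"
    and d4: "\<And>x. x \<in> {t..t+h} \<Longrightarrow> (u3 has_real_derivative u4 x) (at x within {t..t+h})"
    and d5: "\<And>x. x \<in> {t..t+h} \<Longrightarrow> (u4 has_real_derivative u5 x) (at x within {t..t+h})"
    and bound: "\<And>x. x \<in> {t..t+h} \<Longrightarrow> \<bar>u2 x\<bar> \<le> M" "\<And>x. x \<in> {t..t+h} \<Longrightarrow> \<bar>u3 x\<bar> \<le> M"
      "\<And>x. x \<in> {t..t+h} \<Longrightarrow> \<bar>u4 x\<bar> \<le> M" "\<And>x. x \<in> {t..t+h} \<Longrightarrow> \<bar>u5 x\<bar> \<le> M"
    and h: "h > 0" and c: "c > 0" "sqrt (\<sigma>\<^sup>2 + (u1 t)\<^sup>2) \<ge> 2 * c" "M * h \<le> c"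
    and cond: "(u3 t - 3 * u1 t * (u2 t)\<^sup>2 / (\<sigma>\<^sup>2 + (u1 t)\<^sup>2))
      + (u3 (t + h) - 3 * u1 (t + h) * (u2 (t + h))\<^sup>2 / (\<sigma>\<^sup>2 + (u1 (t + h))\<^sup>2)) = 0"
  shows "\<bar>trapezoid_remainder u u1 t (t + h) / h
    + (u1 t - u1 (t + h))\<^sup>2 / 2 * correction \<sigma> (u1 t) (u1 (t + h))\<bar>
    \<le> (M + (4 * M ^ 4 / c ^ 3 + 5 * M\<^sup>2 / c + 10 * M ^ 3 / c\<^sup>2) / 8) * h ^ 4"
proof -
  define d G r s a b where "d = u1 t - u1 (t + h)" and "G = correction \<sigma> (u1 t) (u1 (t + h))"
    and "r = u1 t / (\<sigma>\<^sup>2 + (u1 t)\<^sup>2)" and "s = u1 (t + h) / (\<sigma>\<^sup>2 + (u1 (t + h))\<^sup>2)"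
    and "a = u2 t" and "b = u2 (t + h)"
  \<comment> \<open>The trapezoidal approximation of the slope increment \<open>- d\<close>,
    accurate to third order.\<close>
  define e where "e = h * (a + b) / 2"
  have M: "M \<ge> 0" using bound(1)[of t] h by simp
  have "\<bar>trapezoid_remainder u u1 t (t + h) + h ^ 3 / 24 * (u3 (t + h) + u3 t)\<bar> \<le> M * h ^ 5"
    using trapezoid_expansion_symmetric[OF d1 d2 d3 d4 d5 bound(4), of "t + h"] h by simp
  then have R: "\<bar>(trapezoid_remainder u u1 t (t + h) + h ^ 3 / 24 * (u3 (t + h) + u3 t)) / h\<bar> \<le> M * h ^ 4"
    using h by (simp add: abs_divide divide_simps eval_nat_numeral mult_ac)
  have d: "\<bar>d\<bar> \<le> M * h"
    using derivative_power_bound[OF d2, of M 0 "t + h"] bound(1) h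
    by (simp add: d_def abs_minus_commute)
  have c\<alpha>: "sqrt (\<sigma>\<^sup>2 + (u1 t)\<^sup>2) \<ge> c" using c by linarith
  have c\<beta>: "sqrt (\<sigma>\<^sup>2 + (u1 (t + h))\<^sup>2) \<ge> c"
    using c d sqrt_sum_squares_diff_le[of \<sigma> "u1 t" "u1 (t + h)"] by (simp add: d_def)
  have r: "\<bar>r\<bar> \<le> 1 / c" and s: "\<bar>s\<bar> \<le> 1 / c"
    using weight_bound[OF c(1) c\<alpha>] weight_bound[OF c(1) c\<beta>] by (simp_all add: r_def s_def)
  have rs: "\<bar>r + s\<bar> \<le> 2 * (1 / c)" using r s by linarith
  \<comment> \<open>Both weights are close to \<open>2 * G\<close> by the one-sided expansion at
    either end, hence close to each other.\<close>
  have "\<bar>4 * G - 2 * r\<bar> \<le> 10 / c\<^sup>2 * \<bar>d\<bar>" "\<bar>4 * G - 2 * s\<bar> \<le> 10 / c\<^sup>2 * \<bar>d\<bar>"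
    using correction_expansion_left[OF c(1) c\<alpha>, of "u1 (t + h)"]
      correction_expansion_left[OF c(1) c\<beta>, of "u1 t"]
    by (simp_all add: G_def r_def s_def d_def correction_commute[of _ "u1 (t + h)"]
        abs_minus_commute[of "u1 (t + h)"])
  then have "\<bar>r - s\<bar> \<le> 10 / c\<^sup>2 * \<bar>d\<bar>" by linarith
  also have "\<dots> \<le> 10 / c\<^sup>2 * (M * h)"
    using d by (intro mult_left_mono) auto
  finally have rs': "\<bar>r - s\<bar> \<le> 10 / c\<^sup>2 * (M * h)" .
  have ab: "\<bar>a - b\<bar> \<le> M * h"
    using derivative_power_bound[OF d3, of M 0 "t + h"] bound(2) h
    by (simp add: a_def b_def abs_minus_commute)
  have ab': "\<bar>a + b\<bar> \<le> 2 * M"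
    using bound(1)[of t] bound(1)[of "t + h"] h by (simp add: a_def b_def)
  have de: "\<bar>- d - e\<bar> \<le> M * h ^ 3"
    using trapezoid_bound[OF d2 d3 d4 bound(3), of "t + h"] h
    by (simp add: trapezoid_remainder_def d_def e_def a_def b_def algebra_simps add_divide_distrib)
  have e: "\<bar>e\<bar> \<le> M * h"
    using mult_left_mono[OF ab', of h] h by (simp add: e_def abs_mult mult_ac)
  have "d * d \<le> (M * h) * (M * h)"
    using abs_mult[of d d] d M h mult_mono[OF d d] by simp
  then have dsq: "\<bar>d\<^sup>2\<bar> \<le> (M * h) * (M * h)" by (simp add: power2_eq_square)
  have "\<bar>4 * G - (r + s)\<bar> \<le> 4 / c ^ 3 * d\<^sup>2"
    using correction_expansion_symmetric[OF c(1) c\<alpha> c\<beta>] by (simp add: G_def r_def s_def d_def)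
  also have "\<dots> \<le> 4 / c ^ 3 * ((M * h) * (M * h))"
    using dsq c by (intro mult_left_mono) auto
  finally have "\<bar>d\<^sup>2 * (4 * G - (r + s))\<bar> \<le> (M * h) * (M * h) * (4 / c ^ 3 * ((M * h) * (M * h)))"
    unfolding abs_mult[of "d\<^sup>2"] using dsq M h by (intro mult_mono) auto
  then have 1: "\<bar>d\<^sup>2 * (4 * G - (r + s))\<bar> \<le> 4 * M ^ 4 / c ^ 3 * h ^ 4"
    by (simp add: eval_nat_numeral mult_ac)
  have "\<bar>(r + s) * ((- d - e) * (- d + e))\<bar> \<le> 2 * (1 / c) * ((M * h ^ 3) * (2 * (M * h)))"
    unfolding abs_mult using rs de d e M h c by (intro mult_mono) auto
  then have 2: "\<bar>(r + s) * ((- d - e) * (- d + e))\<bar> \<le> 4 * M\<^sup>2 / c * h ^ 4"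
    by (simp add: eval_nat_numeral mult_ac)
  have "\<bar>(r + s) * ((a - b) * (a - b))\<bar> \<le> 2 * (1 / c) * ((M * h) * (M * h))"
    unfolding abs_mult using rs ab M h c by (intro mult_mono) auto
  then have "h\<^sup>2 * \<bar>(r + s) * ((a - b) * (a - b))\<bar> \<le> h\<^sup>2 * (2 * (1 / c) * ((M * h) * (M * h)))"
    by (intro mult_left_mono) auto
  then have 3: "\<bar>h\<^sup>2 * ((r + s) * ((a - b) * (a - b)))\<bar> \<le> 2 * (M\<^sup>2 / c * h ^ 4)"
    by (simp add: abs_mult eval_nat_numeral mult_ac)
  have "\<bar>(r - s) * ((a - b) * (a + b))\<bar> \<le> 10 / c\<^sup>2 * (M * h) * ((M * h) * (2 * M))"
    unfolding abs_mult using rs' ab ab' M h c by (intro mult_mono) auto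
  then have "h\<^sup>2 * \<bar>(r - s) * ((a - b) * (a + b))\<bar> \<le> h\<^sup>2 * (10 / c\<^sup>2 * (M * h) * ((M * h) * (2 * M)))"
    by (intro mult_left_mono) auto
  then have 4: "\<bar>h\<^sup>2 * ((r - s) * ((a - b) * (a + b)))\<bar> \<le> 2 * (10 * M ^ 3 / c\<^sup>2 * h ^ 4)"
    by (simp add: abs_mult eval_nat_numeral mult_ac)
  have nonneg: "0 \<le> M\<^sup>2 / c * h ^ 4" using c h by simp
  have u3: "u3 (t + h) + u3 t = 3 * (r * a\<^sup>2 + s * b\<^sup>2)"
    using cond by (simp add: r_def s_def a_def b_def algebra_simps)
  \<comment> \<open>Four replacements: \<open>4 * G\<close> by \<open>r + s\<close>,
    \<open>d\<^sup>2\<close> by \<open>e\<^sup>2\<close>, the squared mean of \<open>a\<close> and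
    \<open>b\<close> by the mean of their squares, and the product of averages by
    \<open>r * a\<^sup>2 + s * b\<^sup>2\<close>. The last two produce the terms with
    \<open>a - b\<close>.\<close>
  have "trapezoid_remainder u u1 t (t + h) / h + d\<^sup>2 / 2 * G
    = (trapezoid_remainder u u1 t (t + h) + h ^ 3 / 24 * (u3 (t + h) + u3 t)) / h
      + (d\<^sup>2 * (4 * G - (r + s)) + (r + s) * ((- d - e) * (- d + e))
        - h\<^sup>2 * ((r + s) * ((a - b) * (a - b))) / 4
        - h\<^sup>2 * ((r - s) * ((a - b) * (a + b))) / 2) / 8"
  proof -
    have "(trapezoid_remainder u u1 t (t + h) + h ^ 3 / 24 * (u3 (t + h) + u3 t)) / h
        = trapezoid_remainder u u1 t (t + h) / h + h\<^sup>2 / 24 * (u3 (t + h) + u3 t)"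
      using h by (simp add: add_divide_distrib eval_nat_numeral)
    moreover have "d\<^sup>2 / 2 * G = h\<^sup>2 / 24 * (3 * (r * a\<^sup>2 + s * b\<^sup>2))
      + (d\<^sup>2 * (4 * G - (r + s)) + (r + s) * ((- d - e) * (- d + e))
        - h\<^sup>2 * ((r + s) * ((a - b) * (a - b))) / 4
        - h\<^sup>2 * ((r - s) * ((a - b) * (a + b))) / 2) / 8"
    proof -
      have *: "(- d - e) * (- d + e) = d\<^sup>2 - h\<^sup>2 * (a + b)\<^sup>2 / 4"
        by (simp add: e_def power2_eq_square field_simps)
      show ?thesis
        unfolding * by (simp add: power2_eq_square field_simps)
    qed
    ultimately show ?thesis
      unfolding u3 by linarith
  qed
  \<comment> \<open>The fourth term is over-estimated by \<open>w'\<close> in place of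
    \<open>w' / 2\<close>, which needs \<open>0 \<le> w'\<close>; together with the third term it
    gives the coefficient 5.\<close>
  moreover have "\<bar>x + (y + z - w / 4 - v / 2) / 8\<bar> \<le> x' + (y' + z' + w' + v') / 8"
    if "\<bar>x\<bar> \<le> x'" "\<bar>y\<bar> \<le> y'" "\<bar>z\<bar> \<le> z'" "\<bar>w\<bar> \<le> 2 * w'" "\<bar>v\<bar> \<le> 2 * v'" "0 \<le> w'"
    for x y z w v x' y' z' w' v' :: real
    using that unfolding add_divide_distrib diff_divide_distrib by linarith
  note this[OF R 1 2 3 4 nonneg]
  ultimately have "\<bar>trapezoid_remainder u u1 t (t + h) / h + d\<^sup>2 / 2 * G\<bar>
    \<le> M * h ^ 4 + (4 * M ^ 4 / c ^ 3 * h ^ 4 + 4 * M\<^sup>2 / c * h ^ 4 + M\<^sup>2 / c * h ^ 4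
      + 10 * M ^ 3 / c\<^sup>2 * h ^ 4) / 8"
    by simp
  then show ?thesis
    unfolding d_def G_def by (simp add: algebra_simps)
qed

section \<open>From single steps to the whole grid\<close>

text \<open>The equation is given on the open interval only. Both sides are continuous on the closed
  interval, so it extends to the endpoints, where the first and the last step evaluate
  \<open>F\<close>.\<close>

lemma is_solution_derivative:
  assumes sol: "is_solution \<Omega> F t0 T u0 u" and F: "continuous_on \<Omega> F" and "t0 < T"
    and d1: "\<And>x. x \<in> {t0..T} \<Longrightarrow> (u has_real_derivative u1 x) (at x within {t0..T})"
    and u1: "continuous_on {t0..T} u1" and t: "t \<in> {t0..T}"
  shows "F (t, u t) = u1 t"
proof -
  have u: "continuous_on {t0..T} u"
    using d1 by (meson DERIV_continuous continuous_on_eq_continuous_within)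
  have "continuous_on {t0..T} (\<lambda>t. F (t, u t) - u1 t)"
    using sol by (intro continuous_intros continuous_on_compose2[OF F] u u1) (auto simp: is_solution_def)
  moreover have "F (x, u x) - u1 x = 0" if x: "x \<in> {t0<..<T}" for x
  proof -
    have "(u has_real_derivative F (x, u x)) (at x)"
      using sol x by (auto simp: is_solution_def)
    moreover have "(u has_real_derivative u1 x) (at x)"
      using d1[of x] x by (simp add: at_within_Icc_at)
    ultimately show ?thesis by (simp add: DERIV_unique)
  qed
  ultimately have "F (t, u t) - u1 t = 0"
    using continuous_constant_on_closure[of "{t0<..<T}" "\<lambda>t. F (t, u t) - u1 t" 0 t] \<open>t0 < T\<close> t
    by simp
  then show ?thesis by simp
qed

text \<open>Links the condition that a step ends before \<open>T\<close> with the index range on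
  which the scales are controlled.\<close>

lemma grid_step:
  assumes "0 < h" "0 \<le> t0" "grid t0 h (n + 1) \<le> T"
  shows "{grid t0 h n..grid t0 h n + h} \<subseteq> {t0..T}" "n < num_steps t0 T h"
    "grid t0 h (n + 1) = grid t0 h n + h"
proof -
  show eq: "grid t0 h (n + 1) = grid t0 h n + h"
    by (simp add: grid_def algebra_simps)
  show "{grid t0 h n..grid t0 h n + h} \<subseteq> {t0..T}"
    using assms eq by (auto simp: grid_def intro: order.trans[rotated])
  have "real (n + 1) \<le> (T - t0) / h"
    using assms by (simp add: grid_def field_simps)
  then have "int (n + 1) \<le> \<lfloor>(T - t0) / h\<rfloor>"
    by (simp add: le_floor_iff)
  then show "n < num_steps t0 T h"
    by (simp add: num_steps_def)
qed

theorem corollary4p3: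
  fixes \<Omega> :: "(real \<times> real) set"
    and F :: "real \<times> real \<Rightarrow> real"
    and t0 T u0 H \<eta> :: real
    and u :: "real \<Rightarrow> real"
    and \<sigma> :: "real \<Rightarrow> nat \<Rightarrow> real"
  assumes "open \<Omega>" and "0 \<le> t0" and "t0 < T" and "(t0, u0) \<in> \<Omega>"
    and "Ck_on 2 F \<Omega>"
    and "is_solution \<Omega> F t0 T u0 u"
    and "H > 0" and "\<eta> > 0"
    and "\<And>h n. 0 < h \<Longrightarrow> h \<le> H \<Longrightarrow> n < num_steps t0 T h \<Longrightarrow> \<sigma> h n > 0"
    and "\<And>h n. 0 < h \<Longrightarrow> h \<le> H \<Longrightarrow> n < num_steps t0 T h \<Longrightarrow>
           (\<sigma> h n)\<^sup>2 + (deriv_on {t0..T} u (grid t0 h n))\<^sup>2 \<ge> \<eta>"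
  shows
    "(Ck_on 3 u {t0..T} \<longrightarrow>
       (\<exists>h1 C. 0 < h1 \<and> h1 \<le> H \<and> C > 0 \<and>
         (\<forall>h n. 0 < h \<and> h \<le> h1 \<and> grid t0 h (n + 1) \<le> T \<longrightarrow>
           \<bar>SE_lte F u t0 h (\<sigma> h) n\<bar> \<le> C * h ^ 2))) \<and>
     (Ck_on 4 u {t0..T} \<and>
      (\<forall>h n. 0 < h \<and> h \<le> H \<and> grid t0 h (n + 1) \<le> T \<longrightarrow>
         curvature_deriv {t0..T} (\<sigma> h n) u (grid t0 h n) = 0) \<longrightarrow>
       (\<exists>h2 C. 0 < h2 \<and> h2 \<le> H \<and> C > 0 \<and>
         (\<forall>h n. 0 < h \<and> h \<le> h2 \<and> grid t0 h (n + 1) \<le> T \<longrightarrow>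
           \<bar>SE_lte F u t0 h (\<sigma> h) n\<bar> \<le> C * h ^ 3))) \<and>
     (Ck_on 5 u {t0..T} \<and>
      (\<forall>h n. 0 < h \<and> h \<le> H \<and> grid t0 h (n + 1) \<le> T \<longrightarrow>
         (graph_speed {t0..T} (\<sigma> h n) u (grid t0 h n)) ^ 3 *
           curvature_deriv {t0..T} (\<sigma> h n) u (grid t0 h n) +
         (graph_speed {t0..T} (\<sigma> h n) u (grid t0 h (n + 1))) ^ 3 *
           curvature_deriv {t0..T} (\<sigma> h n) u (grid t0 h (n + 1)) = 0) \<longrightarrow>
       (\<exists>h3 C. 0 < h3 \<and> h3 \<le> H \<and> C > 0 \<and>
         (\<forall>h n. 0 < h \<and> h \<le> h3 \<and> grid t0 h (n + 1) \<le> T \<longrightarrow>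
           \<bar>SE_lte F u t0 h (\<sigma> h) n\<bar> \<le> C * h ^ 4)))"
proof (intro conjI impI)
  note F = Ck_on_imp_continuous_on[OF assms(5)]
  have sqrt_eta: "sqrt \<eta> > 0" using assms(8) by simp
  \<comment> \<open>Everything the three cases share about one step. Only continuity of
    \<open>u1\<close> matters, so the order \<open>k\<close> is left free.\<close>
  have reduce: "SE_lte F u t0 h (\<sigma> h) n = trapezoid_remainder u u1 t (t + h) / h
      + (u1 t - u1 (t + h))\<^sup>2 / 2 * correction (\<sigma> h n) (u1 t) (u1 (t + h))"
    "{t..t + h} \<subseteq> {t0..T}" "\<sigma> h n > 0" "sqrt ((\<sigma> h n)\<^sup>2 + (u1 t)\<^sup>2) \<ge> sqrt \<eta>"
    "grid t0 h (n + 1) = t + h" "t \<in> {t0..T}" "t + h \<in> {t0..T}"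
    if d1: "\<forall>x\<in>{t0..T}. (u has_real_derivative u1 x) (at x within {t0..T})"
      and u1: "Ck_on k u1 {t0..T}"
      and h: "0 < h" "h \<le> H" "grid t0 h (n + 1) \<le> T" and t: "t = grid t0 h n"
    for u1 h n t k
  proof -
    note step = grid_step[OF h(1) assms(2) h(3), folded t]
    show sub: "{t..t + h} \<subseteq> {t0..T}" and "grid t0 h (n + 1) = t + h" by (fact step)+
    then show ts: "t \<in> {t0..T}" "t + h \<in> {t0..T}" using h by auto
    show \<sigma>: "\<sigma> h n > 0" using assms(9)[OF h(1,2) step(2)] .
    have "deriv_on {t0..T} u t = u1 t"
      using deriv_on_real_eqI[OF bspec[OF d1] assms(3)] ts by simp
    then show "sqrt ((\<sigma> h n)\<^sup>2 + (u1 t)\<^sup>2) \<ge> sqrt \<eta>"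
      using assms(10)[OF h(1,2) step(2)] by (simp add: t)
    have "F (s, u s) = u1 s" if "s \<in> {t0..T}" for s
      by (rule is_solution_derivative[OF assms(6) F assms(3) bspec[OF d1] Ck_on_imp_continuous_on[OF u1] that])
    then show "SE_lte F u t0 h (\<sigma> h) n = trapezoid_remainder u u1 t (t + h) / h
      + (u1 t - u1 (t + h))\<^sup>2 / 2 * correction (\<sigma> h n) (u1 t) (u1 (t + h))"
      using ts h(1) \<sigma> by (intro SE_lte_eq t) auto
  qed

  \<comment> \<open>Order 2 for solutions of class C^3\<close>
  show "\<exists>h1 C. 0 < h1 \<and> h1 \<le> H \<and> C > 0 \<and>
      (\<forall>h n. 0 < h \<and> h \<le> h1 \<and> grid t0 h (n + 1) \<le> T \<longrightarrow>
        \<bar>SE_lte F u t0 h (\<sigma> h) n\<bar> \<le> C * h ^ 2)"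
    if C3: "Ck_on 3 u {t0..T}"
  proof -
    obtain u1 where d1: "\<And>x. x \<in> {t0..T} \<Longrightarrow> (u has_real_derivative u1 x) (at x within {t0..T})"
      and C1: "Ck_on 2 u1 {t0..T}"
      using Ck_on_real_derivative[OF C3] by auto
    have D1: "\<forall>x\<in>{t0..T}. (u has_real_derivative u1 x) (at x within {t0..T})"
      using d1 by blast
    obtain u2 where d2: "\<And>x. x \<in> {t0..T} \<Longrightarrow> (u1 has_real_derivative u2 x) (at x within {t0..T})"
      and C2: "Ck_on 1 u2 {t0..T}"
      using Ck_on_real_derivative[OF C1] by auto
    obtain u3 where d3: "\<And>x. x \<in> {t0..T} \<Longrightarrow> (u2 has_real_derivative u3 x) (at x within {t0..T})"
      and C3: "Ck_on 0 u3 {t0..T}"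
      using Ck_on_real_derivative[OF C2] by auto
    obtain M2 M3 where bounds: "\<And>x. x \<in> {t0..T} \<Longrightarrow> \<bar>u2 x\<bar> \<le> M2" "\<And>x. x \<in> {t0..T} \<Longrightarrow> \<bar>u3 x\<bar> \<le> M3"
      using Ck_on_bounded[OF C2] Ck_on_bounded[OF C3] by metis
    \<comment> \<open>The entry 1 makes \<open>M\<close>, and hence the final constant, strictly
      positive.\<close>
    define M where "M = Max {1, M2, M3}"
    have M: "M > 0" by (simp add: M_def Max_gr_iff)
    have boundM: "\<And>x. x \<in> {t0..T} \<Longrightarrow> \<bar>u2 x\<bar> \<le> M"
      "\<And>x. x \<in> {t0..T} \<Longrightarrow> \<bar>u3 x\<bar> \<le> M"
      using bounds by (fastforce simp: M_def le_max_iff_disj)+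
    have "\<bar>SE_lte F u t0 h (\<sigma> h) n\<bar> \<le> (M + M\<^sup>2 / sqrt \<eta>) * h ^ 2"
      if h: "0 < h" "h \<le> H" "grid t0 h (n + 1) \<le> T" for h n
    proof -
      note red = reduce[OF D1 C1 h refl]
      note sub = subsetD[OF red(2)]
      show ?thesis
        unfolding red(1)
        by (rule SE_order_2[where ?u2.0 = u2 and ?u3.0 = u3])
          (use h(1) red(3,4) sub sqrt_eta boundM
             DERIV_subset[OF d1 red(2)]
             DERIV_subset[OF d2 red(2)]
             DERIV_subset[OF d3 red(2)] in blast)+
    qed
    moreover have "M + M\<^sup>2 / sqrt \<eta> > 0"
      using M sqrt_eta by (simp add: add_pos_nonneg)
    ultimately show ?thesis
      using assms(7) by blast
  qed

  \<comment> \<open>Order 3 for vanishing curvature derivative\<close>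
  show "\<exists>h2 C. 0 < h2 \<and> h2 \<le> H \<and> C > 0 \<and>
      (\<forall>h n. 0 < h \<and> h \<le> h2 \<and> grid t0 h (n + 1) \<le> T \<longrightarrow>
        \<bar>SE_lte F u t0 h (\<sigma> h) n\<bar> \<le> C * h ^ 3)"
    if asm: "Ck_on 4 u {t0..T} \<and>
      (\<forall>h n. 0 < h \<and> h \<le> H \<and> grid t0 h (n + 1) \<le> T \<longrightarrow>
         curvature_deriv {t0..T} (\<sigma> h n) u (grid t0 h n) = 0)"
  proof -
    from asm have C4: "Ck_on 4 u {t0..T}" by blast
    obtain u1 where d1: "\<And>x. x \<in> {t0..T} \<Longrightarrow> (u has_real_derivative u1 x) (at x within {t0..T})"
      and C1: "Ck_on 3 u1 {t0..T}"
      using Ck_on_real_derivative[OF C4] by auto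
    have D1: "\<forall>x\<in>{t0..T}. (u has_real_derivative u1 x) (at x within {t0..T})"
      using d1 by blast
    obtain u2 where d2: "\<And>x. x \<in> {t0..T} \<Longrightarrow> (u1 has_real_derivative u2 x) (at x within {t0..T})"
      and C2: "Ck_on 2 u2 {t0..T}"
      using Ck_on_real_derivative[OF C1] by auto
    obtain u3 where d3: "\<And>x. x \<in> {t0..T} \<Longrightarrow> (u2 has_real_derivative u3 x) (at x within {t0..T})"
      and C3: "Ck_on 1 u3 {t0..T}"
      using Ck_on_real_derivative[OF C2] by auto
    obtain u4 where d4: "\<And>x. x \<in> {t0..T} \<Longrightarrow> (u3 has_real_derivative u4 x) (at x within {t0..T})"
      and C4: "Ck_on 0 u4 {t0..T}"
      using Ck_on_real_derivative[OF C3] by auto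
    obtain M2 M3 M4 where bounds: "\<And>x. x \<in> {t0..T} \<Longrightarrow> \<bar>u2 x\<bar> \<le> M2"
      "\<And>x. x \<in> {t0..T} \<Longrightarrow> \<bar>u3 x\<bar> \<le> M3" "\<And>x. x \<in> {t0..T} \<Longrightarrow> \<bar>u4 x\<bar> \<le> M4"
      using Ck_on_bounded[OF C2] Ck_on_bounded[OF C3] Ck_on_bounded[OF C4] by metis
    have curv: "curvature_deriv {t0..T} s u t
        = s\<^sup>2 * (u3 t - 3 * u1 t * (u2 t)\<^sup>2 / (s\<^sup>2 + (u1 t)\<^sup>2)) / sqrt (s\<^sup>2 + (u1 t)\<^sup>2) ^ 3"
      if "t \<in> {t0..T}" "s > 0" for s t
      by (rule curvature_deriv_eq) (use that d1 d2 d3 assms(3) in auto)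
    define M where "M = Max {1, M2, M3, M4}"
    have M: "M > 0" by (simp add: M_def Max_gr_iff)
    have boundM: "\<And>x. x \<in> {t0..T} \<Longrightarrow> \<bar>u2 x\<bar> \<le> M"
      "\<And>x. x \<in> {t0..T} \<Longrightarrow> \<bar>u3 x\<bar> \<le> M"
      "\<And>x. x \<in> {t0..T} \<Longrightarrow> \<bar>u4 x\<bar> \<le> M"
      using bounds by (fastforce simp: M_def le_max_iff_disj)+
    have "\<bar>SE_lte F u t0 h (\<sigma> h) n\<bar>
        \<le> (M + (10 * M ^ 3 / (sqrt \<eta>)\<^sup>2 + 4 * M\<^sup>2 / sqrt \<eta>) / 8) * h ^ 3"
      if h: "0 < h" "h \<le> H" "grid t0 h (n + 1) \<le> T" for h n
    proof -
      note red = reduce[OF D1 C1 h refl]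
      note sub = subsetD[OF red(2)]
      let ?t = "grid t0 h n"
      have pos: "(\<sigma> h n)\<^sup>2 + (u1 ?t)\<^sup>2 > 0"
        using red(3) by (simp add: add_pos_nonneg)
      have "curvature_deriv {t0..T} (\<sigma> h n) u ?t = 0"
        using asm h by blast
      then have cond: "u3 ?t = 3 * u1 ?t * (u2 ?t)\<^sup>2 / ((\<sigma> h n)\<^sup>2 + (u1 ?t)\<^sup>2)"
        unfolding curv[OF red(6,3)] using red(3) pos by simp
      show ?thesis
        unfolding red(1)
        by (rule SE_order_3[where t = ?t and \<sigma> = "\<sigma> h n" and ?u1.0 = u1
              and ?u2.0 = u2 and ?u3.0 = u3 and ?u4.0 = u4,
            OF _ _ _ _ _ _ _ _ _ _ cond])
          (use h(1) red(3,4) sub sqrt_eta boundM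
             DERIV_subset[OF d1 red(2)]
             DERIV_subset[OF d2 red(2)]
             DERIV_subset[OF d3 red(2)]
             DERIV_subset[OF d4 red(2)] in blast)+
    qed
    moreover have "M + (10 * M ^ 3 / (sqrt \<eta>)\<^sup>2 + 4 * M\<^sup>2 / sqrt \<eta>) / 8 > 0"
      using M sqrt_eta by (intro add_pos_nonneg) auto
    ultimately show ?thesis
      using assms(7) by blast
  qed

  \<comment> \<open>Order 4 for the symmetric curvature condition\<close>
  show "\<exists>h3 C. 0 < h3 \<and> h3 \<le> H \<and> C > 0 \<and>
      (\<forall>h n. 0 < h \<and> h \<le> h3 \<and> grid t0 h (n + 1) \<le> T \<longrightarrow>
        \<bar>SE_lte F u t0 h (\<sigma> h) n\<bar> \<le> C * h ^ 4)"
    if asm: "Ck_on 5 u {t0..T} \<and>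
      (\<forall>h n. 0 < h \<and> h \<le> H \<and> grid t0 h (n + 1) \<le> T \<longrightarrow>
         (graph_speed {t0..T} (\<sigma> h n) u (grid t0 h n)) ^ 3 *
           curvature_deriv {t0..T} (\<sigma> h n) u (grid t0 h n) +
         (graph_speed {t0..T} (\<sigma> h n) u (grid t0 h (n + 1))) ^ 3 *
           curvature_deriv {t0..T} (\<sigma> h n) u (grid t0 h (n + 1)) = 0)"
  proof -
    from asm have C5: "Ck_on 5 u {t0..T}" by blast
    obtain u1 where d1: "\<And>x. x \<in> {t0..T} \<Longrightarrow> (u has_real_derivative u1 x) (at x within {t0..T})"
      and C1: "Ck_on 4 u1 {t0..T}"
      using Ck_on_real_derivative[OF C5] by auto
    have D1: "\<forall>x\<in>{t0..T}. (u has_real_derivative u1 x) (at x within {t0..T})"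
      using d1 by blast
    obtain u2 where d2: "\<And>x. x \<in> {t0..T} \<Longrightarrow> (u1 has_real_derivative u2 x) (at x within {t0..T})"
      and C2: "Ck_on 3 u2 {t0..T}"
      using Ck_on_real_derivative[OF C1] by auto
    obtain u3 where d3: "\<And>x. x \<in> {t0..T} \<Longrightarrow> (u2 has_real_derivative u3 x) (at x within {t0..T})"
      and C3: "Ck_on 2 u3 {t0..T}"
      using Ck_on_real_derivative[OF C2] by auto
    obtain u4 where d4: "\<And>x. x \<in> {t0..T} \<Longrightarrow> (u3 has_real_derivative u4 x) (at x within {t0..T})"
      and C4: "Ck_on 1 u4 {t0..T}"
      using Ck_on_real_derivative[OF C3] by auto
    obtain u5 where d5: "\<And>x. x \<in> {t0..T} \<Longrightarrow> (u4 has_real_derivative u5 x) (at x within {t0..T})"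
      and C5: "Ck_on 0 u5 {t0..T}"
      using Ck_on_real_derivative[OF C4] by auto
    obtain M2 M3 M4 M5 where bounds: "\<And>x. x \<in> {t0..T} \<Longrightarrow> \<bar>u2 x\<bar> \<le> M2"
      "\<And>x. x \<in> {t0..T} \<Longrightarrow> \<bar>u3 x\<bar> \<le> M3" "\<And>x. x \<in> {t0..T} \<Longrightarrow> \<bar>u4 x\<bar> \<le> M4"
      "\<And>x. x \<in> {t0..T} \<Longrightarrow> \<bar>u5 x\<bar> \<le> M5"
      using Ck_on_bounded[OF C2] Ck_on_bounded[OF C3] Ck_on_bounded[OF C4] Ck_on_bounded[OF C5] by metis
    have curv: "curvature_deriv {t0..T} s u t
        = s\<^sup>2 * (u3 t - 3 * u1 t * (u2 t)\<^sup>2 / (s\<^sup>2 + (u1 t)\<^sup>2)) / sqrt (s\<^sup>2 + (u1 t)\<^sup>2) ^ 3"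
      if "t \<in> {t0..T}" "s > 0" for s t
      by (rule curvature_deriv_eq) (use that d1 d2 d3 assms(3) in auto)
    \<comment> \<open>Half of the lower bound is held in reserve: over one step with
      \<open>h \<le> c / M\<close> the root changes by at most \<open>c\<close>, whatever the
      scale.\<close>
    define M c where "M = Max {1, M2, M3, M4, M5}" and "c = sqrt \<eta> / 2"
    have M: "M > 0" by (simp add: M_def Max_gr_iff)
    have boundM: "\<And>x. x \<in> {t0..T} \<Longrightarrow> \<bar>u2 x\<bar> \<le> M"
      "\<And>x. x \<in> {t0..T} \<Longrightarrow> \<bar>u3 x\<bar> \<le> M"
      "\<And>x. x \<in> {t0..T} \<Longrightarrow> \<bar>u4 x\<bar> \<le> M"
      "\<And>x. x \<in> {t0..T} \<Longrightarrow> \<bar>u5 x\<bar> \<le> M"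
      using bounds by (fastforce simp: M_def le_max_iff_disj)+
    have c: "c > 0" "sqrt \<eta> = 2 * c" using sqrt_eta by (simp_all add: c_def)
    have "\<bar>SE_lte F u t0 h (\<sigma> h) n\<bar>
        \<le> (M + (4 * M ^ 4 / c ^ 3 + 5 * M\<^sup>2 / c + 10 * M ^ 3 / c\<^sup>2) / 8) * h ^ 4"
      if h: "0 < h" "h \<le> H" "grid t0 h (n + 1) \<le> T" and small: "h \<le> c / M" for h n
    proof -
      note red = reduce[OF D1 C1 h refl]
      note sub = subsetD[OF red(2)]
      let ?t = "grid t0 h n"
      let ?E = "\<lambda>s. u3 s - 3 * u1 s * (u2 s)\<^sup>2 / ((\<sigma> h n)\<^sup>2 + (u1 s)\<^sup>2)"
      \<comment> \<open>The cubed speed cancels the root in the denominator and leaves the factor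
        \<open>1 / \<sigma> h n\<close>, the same at both endpoints, so the condition says that the
        two values of \<open>?E\<close> sum to zero.\<close>
      have "(graph_speed {t0..T} (\<sigma> h n) u s) ^ 3 * curvature_deriv {t0..T} (\<sigma> h n) u s = ?E s / \<sigma> h n"
        if s: "s \<in> {t0..T}" for s
      proof -
        define w where "w = sqrt ((\<sigma> h n)\<^sup>2 + (u1 s)\<^sup>2)"
        have "(\<sigma> h n)\<^sup>2 + (u1 s)\<^sup>2 > 0"
          using red(3) by (simp add: add_pos_nonneg)
        then have "w > 0" by (simp add: w_def)
        have "(w / \<sigma> h n) ^ 3 * ((\<sigma> h n)\<^sup>2 * E / w ^ 3) = E / \<sigma> h n" for E
          using \<open>w > 0\<close> red(3) by (simp add: power_divide eval_nat_numeral)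
        then show ?thesis
          unfolding curv[OF s red(3)]
            graph_speed_eq[OF d1[OF s] assms(3) s red(3)] w_def[symmetric] by blast
      qed
      moreover have "(graph_speed {t0..T} (\<sigma> h n) u ?t) ^ 3 * curvature_deriv {t0..T} (\<sigma> h n) u ?t
          + (graph_speed {t0..T} (\<sigma> h n) u (?t + h)) ^ 3 * curvature_deriv {t0..T} (\<sigma> h n) u (?t + h) = 0"
        using asm h unfolding red(5)[symmetric] by blast
      ultimately have "(?E ?t + ?E (?t + h)) / \<sigma> h n = 0"
        using red(6,7) by (simp only: add_divide_distrib)
      then have cond: "?E ?t + ?E (?t + h) = 0"
        using red(3) by simp
      have "M * h \<le> c"
        using small M by (simp add: field_simps)
      have spd: "2 * c \<le> sqrt ((\<sigma> h n)\<^sup>2 + (u1 ?t)\<^sup>2)"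
        using red(4) c(2) by simp
      show ?thesis
        unfolding red(1)
        by (intro SE_order_4[where t = ?t and \<sigma> = "\<sigma> h n" and ?u1.0 = u1
              and ?u2.0 = u2 and ?u3.0 = u3 and ?u4.0 = u4 and ?u5.0 = u5,
            OF _ _ _ _ _ _ _ _ _ _ _ _ _ cond])
          (use h(1) c(1) spd \<open>M * h \<le> c\<close> sub boundM
             DERIV_subset[OF d1 red(2)]
             DERIV_subset[OF d2 red(2)]
             DERIV_subset[OF d3 red(2)]
             DERIV_subset[OF d4 red(2)]
             DERIV_subset[OF d5 red(2)] in blast)+
    qed
    moreover have "M + (4 * M ^ 4 / c ^ 3 + 5 * M\<^sup>2 / c + 10 * M ^ 3 / c\<^sup>2) / 8 > 0"
      using M c by (intro add_pos_nonneg) auto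
    \<comment> \<open>The threshold \<open>h3\<close>; in the two other cases \<open>H\<close>
      itself serves.\<close>
    moreover have "0 < min H (c / M)" "min H (c / M) \<le> H"
      using assms(7) M c by auto
    ultimately show ?thesis
      by (metis min.bounded_iff)
  qed
qed

end
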